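(* Let $Q=Q(\mathbb{K},\mathbb{L},\mathbb{K}',\alpha,\beta)$ be an exceptional Moufang quadrangle of type $\mathsf{F}_4$ and let $\rho$ be a polarity of $Q$. Then every automorphism of $Q$ stabilizing the set of absolute points of $\rho$ also stabilizes the set of absolute lines of $\rho$ and centralizes (commutes with) $\rho$.
   Context: **Conventions.** $[a,b]=a^{-1}b^{-1}ab$. Automorphisms of a quadrangle are type-preserving (points to points, lines to lines). A polarity is an involutory incidence-preserving map interchanging points and lines. A point or line is absolute if it is incident with its image under the polarity. **The quadrangle.** $\mathbb{K}$ is a field of characteristic 2, $\mathbb{L}$ a separable quadratic extension of $\mathbb{K}$, $x\mapsto\bar x$ the nontrivial automorphism of $\mathbb{L}$ fixing $\mathbb{K}$ pointwise, $\mathbb{K}'$ a subfield of $\mathbb{K}$ containing $\mathbb{K}^2$, and $\mathbb{L}'$ the subfield of $\mathbb{L}$ generated by $\mathbb{L}^2$ and $\mathbb{K}'$. Elements $\alpha\in\mathbb{K}'$, $\beta\in\mathbb{K}$ are given such that for all $u,v\in\mathbb{L}$, $a\in\mathbb{K}'$: $u\bar u+\alpha v\bar v+\beta a=0$ implies $u=v=a=0$ (equivalently, for all $x,y\in\mathbb{L}'$, $b\in\mathbb{K}$: $x\bar x+\beta^2y\bar y+\alpha b^2=0$ implies $x=y=b=0$). Let $U_1,U_3$ be copies of the additive group $\mathbb{L}'\times\mathbb{L}'\times\mathbb{K}$ and $U_2,U_4$ copies of $\mathbb{L}\times\mathbb{L}\times\mathbb{K}'$ (elements written with subscript $i$). Let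 $U_+=U_1U_2U_3U_4$ (unique factorization) be the group defined by $[U_1,U_2]=[U_2,U_3]=[U_3,U_4]=1$ and - $[(x,y,b)_1,(x',y',b')_3]=(0,0,\alpha(x\bar x'+x'\bar x+\beta^2(y\bar y'+y'\bar y)))_2$, - $[(u,v,a)_2,(u',v',a')_4]=(0,0,\beta^{-1}(u\bar u'+u'\bar u+\alpha(v\bar v'+v'\bar v)))_3$, - $[(x,y,b)_1,(u,v,a)_4]=(p_1,p_2,p_3)_2\,(r_1,r_2,r_3)_3$ with $p_1=bu+\alpha(\bar xv+\beta y\bar v)$, $p_2=bv+xu+\beta y\bar u$, $p_3=b^2a+a\alpha(x\bar x+\beta^2y\bar y)+\alpha(u^2x\bar y+\bar u^2\bar xy+\alpha(\bar v^2xy+v^2\bar x\bar y))$, $r_1=ax+\bar u^2y+\alpha v^2\bar y$, $r_2=ay+\beta^{-2}(u^2x+\alpha v^2\bar x)$, $r_3=ab+b\beta^{-1}(u\bar u+\alpha v\bar v)+\alpha(\beta^{-1}(xu\bar v+\bar x\bar uv)+y\bar u\bar v+\bar yuv)$. The exceptional quadrangle of type $\mathsf{F}_4$, $Q=Q(\mathbb{K},\mathbb{L},\mathbb{K}',\alpha,\beta)$, is the Moufang generalized quadrangle with root group sequence $(U_+,U_1,U_2,U_3,U_4)$: it has an apartment with vertices $x_0,\dots,x_7$ (indices mod 8, $x_i$ incident with $x_{i+1}$; one parity class consists of points, the other of lines) such that $U_i$ is the root group of the root $(x_i,\dots,x_{i+4})$, i.e. the group of automorphisms fixing every element incident with one of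 $x_{i+1},x_{i+2},x_{i+3}$. *)

theory Defs
  imports
    "HOL-Computational_Algebra.Polynomial"
    "HOL-Library.Product_Plus"
    "HOL.Hull"
begin

section \<open>Field data\<close>

text \<open>The big field \<open>L\<close> is the type \<open>'f\<close>; the fields \<open>K\<close>, \<open>K'\<close>, \<open>L'\<close> are subsets of it.\<close>

definition is_subfield :: "'f::field set \<Rightarrow> bool" where
  "is_subfield F \<longleftrightarrow> 0 \<in> F \<and> 1 \<in> F
     \<and> (\<forall>x\<in>F. \<forall>y\<in>F. x + y \<in> F \<and> x * y \<in> F)
     \<and> (\<forall>x\<in>F. - x \<in> F \<and> inverse x \<in> F)"

definition poly_over :: "'f::field set \<Rightarrow> 'f poly \<Rightarrow> bool" where
  "poly_over K p \<longleftrightarrow> (\<forall>i. coeff p i \<in> K)"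

definition minimal_poly :: "'f::field set \<Rightarrow> 'f \<Rightarrow> 'f poly \<Rightarrow> bool" where
  "minimal_poly K x p \<longleftrightarrow> poly_over K p \<and> lead_coeff p = 1 \<and> poly p x = 0
     \<and> (\<forall>q. poly_over K q \<and> q \<noteq> 0 \<and> poly q x = 0 \<longrightarrow> degree p \<le> degree q)"

text \<open>Coprimality of \<open>p\<close> and \<open>pderiv p\<close> over \<open>'f\<close> is the same as over the subfield \<open>K\<close>.\<close>

definition separable_over :: "'f::field set \<Rightarrow> bool" where
  "separable_over K \<longleftrightarrow> (\<forall>x. \<exists>p. minimal_poly K x p \<and> coprime p (pderiv p))"

definition quadratic_over :: "'f::field set \<Rightarrow> bool" where
  "quadratic_over K \<longleftrightarrow> (\<exists>s t. bij_betw (\<lambda>(a, b). a * s + b * t) (K \<times> K) UNIV)"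

definition field_automorphism_over :: "'f::field set \<Rightarrow> ('f \<Rightarrow> 'f) \<Rightarrow> bool" where
  "field_automorphism_over K \<sigma> \<longleftrightarrow> bij \<sigma>
     \<and> (\<forall>x y. \<sigma> (x + y) = \<sigma> x + \<sigma> y \<and> \<sigma> (x * y) = \<sigma> x * \<sigma> y)
     \<and> (\<forall>x\<in>K. \<sigma> x = x)"

locale F4_data =
  fixes K K' :: "'f::field set" and bar :: "'f \<Rightarrow> 'f" and \<alpha> \<beta> :: 'f
  assumes char_2: "CHAR('f) = 2"
    and subfield_K: "is_subfield K"
    and quadratic: "quadratic_over K"
    and separable: "separable_over K"
    and bar_automorphism: "field_automorphism_over K bar"
    and bar_nontrivial: "bar \<noteq> id"
    and subfield_K': "is_subfield K'"
    and K'_subset: "K' \<subseteq> K"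
    and squares_subset: "(\<lambda>x. x\<^sup>2) ` K \<subseteq> K'"
    and \<alpha>_in: "\<alpha> \<in> K'"
    and \<beta>_in: "\<beta> \<in> K"
    and anisotropic:
      "\<And>u v a. a \<in> K' \<Longrightarrow> u * bar u + \<alpha> * v * bar v + \<beta> * a = 0
         \<Longrightarrow> u = 0 \<and> v = 0 \<and> a = 0"
begin

definition L' :: "'f set" where
  "L' = is_subfield hull (range (\<lambda>x. x\<^sup>2) \<union> K')"

text \<open>The parameter group of \<open>U\<^sub>i\<close>, with componentwise addition.\<close>

definition V :: "nat \<Rightarrow> ('f \<times> 'f \<times> 'f) set" where
  "V i = (if odd i then L' \<times> L' \<times> K else UNIV \<times> UNIV \<times> K')"

fun comm13 :: "'f \<times> 'f \<times> 'f \<Rightarrow> 'f \<times> 'f \<times> 'f \<Rightarrow> 'f \<times> 'f \<times> 'f" where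
  "comm13 (x, y, b) (x', y', b') =
     (0, 0, \<alpha> * (x * bar x' + x' * bar x + \<beta>\<^sup>2 * (y * bar y' + y' * bar y)))"

fun comm24 :: "'f \<times> 'f \<times> 'f \<Rightarrow> 'f \<times> 'f \<times> 'f \<Rightarrow> 'f \<times> 'f \<times> 'f" where
  "comm24 (u, v, a) (u', v', a') =
     (0, 0, inverse \<beta> * (u * bar u' + u' * bar u + \<alpha> * (v * bar v' + v' * bar v)))"

text \<open>The two components, in \<open>U\<^sub>2\<close> and \<open>U\<^sub>3\<close>, of a commutator of \<open>U\<^sub>1\<close> with \<open>U\<^sub>4\<close>.\<close>

fun comm14_2 :: "'f \<times> 'f \<times> 'f \<Rightarrow> 'f \<times> 'f \<times> 'f \<Rightarrow> 'f \<times> 'f \<times> 'f" where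
  "comm14_2 (x, y, b) (u, v, a) =
     (b * u + \<alpha> * (bar x * v + \<beta> * y * bar v),
      b * v + x * u + \<beta> * y * bar u,
      b\<^sup>2 * a + a * \<alpha> * (x * bar x + \<beta>\<^sup>2 * y * bar y)
        + \<alpha> * (u\<^sup>2 * x * bar y + (bar u)\<^sup>2 * bar x * y
               + \<alpha> * ((bar v)\<^sup>2 * x * y + v\<^sup>2 * bar x * bar y)))"

fun comm14_3 :: "'f \<times> 'f \<times> 'f \<Rightarrow> 'f \<times> 'f \<times> 'f \<Rightarrow> 'f \<times> 'f \<times> 'f" where
  "comm14_3 (x, y, b) (u, v, a) =
     (a * x + (bar u)\<^sup>2 * y + \<alpha> * v\<^sup>2 * bar y,
      a * y + inverse (\<beta>\<^sup>2) * (u\<^sup>2 * x + \<alpha> * v\<^sup>2 * bar x),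
      a * b + b * inverse \<beta> * (u * bar u + \<alpha> * v * bar v)
        + \<alpha> * (inverse \<beta> * (x * u * bar v + bar x * bar u * v)
               + y * bar u * bar v + bar y * u * v))"

end


section \<open>Moufang quadrangles\<close>

text \<open>A point-line geometry is given by its incidence graph: the type \<open>'v\<close> of all points
  and lines, the sets \<open>Pt\<close> of points and \<open>Ln\<close> of lines, and the symmetric relation \<open>inc\<close>.
  The axioms are those of a thick generalized quadrangle.\<close>

locale generalized_quadrangle =
  fixes Pt Ln :: "'v set" and inc :: "'v \<Rightarrow> 'v \<Rightarrow> bool"
  assumes Pt_Ln: "Pt \<inter> Ln = {}" "Pt \<union> Ln = UNIV"
    and inc_sym: "inc x y \<Longrightarrow> inc y x"
    and inc_type: "inc x y \<Longrightarrow> x \<in> Pt \<longleftrightarrow> y \<in> Ln"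
    and linear: "\<lbrakk>p \<in> Pt; q \<in> Pt; p \<noteq> q; inc p l; inc q l; inc p m; inc q m\<rbrakk> \<Longrightarrow> l = m"
    and projection: "\<lbrakk>p \<in> Pt; l \<in> Ln; \<not> inc p l\<rbrakk>
      \<Longrightarrow> \<exists>!(q, m). inc p m \<and> inc q m \<and> inc q l"
    and thick: "\<exists>A \<subseteq> {y. inc x y}. card A = 3"

definition automorphism :: "'v set \<Rightarrow> 'v set \<Rightarrow> ('v \<Rightarrow> 'v \<Rightarrow> bool) \<Rightarrow> ('v \<Rightarrow> 'v) \<Rightarrow> bool" where
  "automorphism Pt Ln inc \<phi> \<longleftrightarrow> bij \<phi> \<and> \<phi> ` Pt = Pt \<and> \<phi> ` Ln = Ln
     \<and> (\<forall>x y. inc (\<phi> x) (\<phi> y) \<longleftrightarrow> inc x y)"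

definition polarity :: "'v set \<Rightarrow> 'v set \<Rightarrow> ('v \<Rightarrow> 'v \<Rightarrow> bool) \<Rightarrow> ('v \<Rightarrow> 'v) \<Rightarrow> bool" where
  "polarity Pt Ln inc \<rho> \<longleftrightarrow> \<rho> \<circ> \<rho> = id \<and> \<rho> ` Pt = Ln \<and> \<rho> ` Ln = Pt
     \<and> (\<forall>x y. inc x y \<longrightarrow> inc (\<rho> x) (\<rho> y))"

definition absolute_points :: "'v set \<Rightarrow> ('v \<Rightarrow> 'v \<Rightarrow> bool) \<Rightarrow> ('v \<Rightarrow> 'v) \<Rightarrow> 'v set" where
  "absolute_points Pt inc \<rho> = {p \<in> Pt. inc p (\<rho> p)}"

definition absolute_lines :: "'v set \<Rightarrow> ('v \<Rightarrow> 'v \<Rightarrow> bool) \<Rightarrow> ('v \<Rightarrow> 'v) \<Rightarrow> 'v set" where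
  "absolute_lines Ln inc \<rho> = {l \<in> Ln. inc l (\<rho> l)}"

text \<open>An apartment is labelled by the naturals modulo 8.\<close>

definition apartment :: "('v \<Rightarrow> 'v \<Rightarrow> bool) \<Rightarrow> (nat \<Rightarrow> 'v) \<Rightarrow> bool" where
  "apartment inc x \<longleftrightarrow> (\<forall>i. x (i + 8) = x i) \<and> inj_on x {..<8} \<and> (\<forall>i. inc (x i) (x (i + 1)))"

text \<open>The root group of the root \<open>(x i, \<dots>, x (i + 4))\<close> of the apartment \<open>x\<close>.\<close>

definition root_group ::
  "'v set \<Rightarrow> 'v set \<Rightarrow> ('v \<Rightarrow> 'v \<Rightarrow> bool) \<Rightarrow> (nat \<Rightarrow> 'v) \<Rightarrow> nat \<Rightarrow> ('v \<Rightarrow> 'v) set" where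
  "root_group Pt Ln inc x i =
     {g. automorphism Pt Ln inc g \<and> (\<forall>j\<in>{i + 1, i + 2, i + 3}. \<forall>y. inc (x j) y \<longrightarrow> g y = y)}"

text \<open>Each root group acts transitively on the apartments containing its root. Every root is of
  the form \<open>(x 0, \<dots>, x 4)\<close> for a suitable labelling \<open>x\<close> of an apartment.\<close>

locale moufang_quadrangle = generalized_quadrangle +
  assumes moufang: "\<lbrakk>apartment inc x; apartment inc y; \<And>i. i \<le> 4 \<Longrightarrow> x i = y i\<rbrakk>
    \<Longrightarrow> \<exists>g \<in> root_group Pt Ln inc x 0. \<forall>i. g (x i) = y i"


section \<open>The exceptional quadrangles of type F4\<close>

text \<open>The product of two automorphisms is their composite. As all parameter groups have exponent 2
  and \<open>U\<^sub>2\<close>, \<open>U\<^sub>3\<close> commute, the relations below are the same for the opposite product.\<close>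

definition commutator :: "('v \<Rightarrow> 'v) \<Rightarrow> ('v \<Rightarrow> 'v) \<Rightarrow> 'v \<Rightarrow> 'v" where
  "commutator g h = inv g \<circ> inv h \<circ> g \<circ> h"

text \<open>\<open>e i\<close> is the isomorphism from the parameter group \<open>V i\<close> onto the root group \<open>U\<^sub>i\<close>.\<close>

locale F4_coordinates =
  F4_data K K' bar \<alpha> \<beta> + moufang_quadrangle Pt Ln inc
  for K K' :: "'f::field set" and bar \<alpha> \<beta> and Pt Ln :: "'v set" and inc +
  fixes x :: "nat \<Rightarrow> 'v" and e :: "nat \<Rightarrow> 'f \<times> 'f \<times> 'f \<Rightarrow> 'v \<Rightarrow> 'v"
  assumes apartment: "apartment inc x"
    and e_bij: "i \<in> {1..4} \<Longrightarrow> bij_betw (e i) (V i) (root_group Pt Ln inc x i)"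
    and e_hom: "\<lbrakk>i \<in> {1..4}; s \<in> V i; t \<in> V i\<rbrakk> \<Longrightarrow> e i (s + t) = e i s \<circ> e i t"
    and factorization:
      "inj_on (\<lambda>(s, t, s', t'). e 1 s \<circ> e 2 t \<circ> e 3 s' \<circ> e 4 t') (V 1 \<times> V 2 \<times> V 3 \<times> V 4)"
    and comm_trivial:
      "\<lbrakk>i \<in> {1..3}; s \<in> V i; t \<in> V (i + 1)\<rbrakk> \<Longrightarrow> commutator (e i s) (e (i + 1) t) = id"
    and comm_1_3:
      "\<lbrakk>s \<in> V 1; t \<in> V 3\<rbrakk> \<Longrightarrow> commutator (e 1 s) (e 3 t) = e 2 (comm13 s t)"
    and comm_2_4:
      "\<lbrakk>s \<in> V 2; t \<in> V 4\<rbrakk> \<Longrightarrow> commutator (e 2 s) (e 4 t) = e 3 (comm24 s t)"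
    and comm_1_4:
      "\<lbrakk>s \<in> V 1; t \<in> V 4\<rbrakk>
        \<Longrightarrow> commutator (e 1 s) (e 4 t) = e 2 (comm14_2 s t) \<circ> e 3 (comm14_3 s t)"

definition exceptional_F4_quadrangle ::
  "'f::field set \<Rightarrow> 'f set \<Rightarrow> ('f \<Rightarrow> 'f) \<Rightarrow> 'f \<Rightarrow> 'f
    \<Rightarrow> 'v set \<Rightarrow> 'v set \<Rightarrow> ('v \<Rightarrow> 'v \<Rightarrow> bool) \<Rightarrow> bool" where
  "exceptional_F4_quadrangle K K' bar \<alpha> \<beta> Pt Ln inc \<longleftrightarrow>
     (\<exists>x e. F4_coordinates K K' bar \<alpha> \<beta> Pt Ln inc x e)"

end

theory Submission
  imports Defs
begin

text \<open>If \<open>\<phi>\<close> stabilizes the set \<open>O\<close> of absolute points of \<open>\<rho>\<close>, then \<open>\<rho>' = \<phi> \<rho> \<phi>\<^sup>-\<^sup>1\<close> is a polarity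
  with the same absolute points. A polarity is determined by its restriction to \<open>O\<close>, so suppose that
  \<open>l = \<rho> p\<close> and \<open>m = \<rho>' p\<close> differ for some \<open>p \<in> O\<close>. The path \<open>(\<rho>' l, m, p, l, \<rho> m)\<close> carries
  root groups \<open>U\<^sub>1\<close>, \<open>U\<^sub>2\<close>, \<open>U\<^sub>3\<close>, where \<open>\<rho>\<close> interchanges \<open>U\<^sub>2\<close> and \<open>U\<^sub>3\<close> and \<open>\<rho>'\<close> interchanges
  \<open>U\<^sub>1\<close> and \<open>U\<^sub>2\<close>. As \<open>U\<^sub>2\<close> is central in \<open>U\<^sub>1 U\<^sub>2 U\<^sub>3\<close>, the elements \<open>u\<^sub>3 (\<rho> u\<^sub>3 \<rho>)\<close> and \<open>u\<^sub>1 (\<rho>' u\<^sub>1 \<rho>')\<close>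
  centralize \<open>\<rho>\<close> and \<open>\<rho>'\<close>, hence stabilize \<open>O\<close>, and so does their commutator \<open>[u\<^sub>3, u\<^sub>1] \<in> U\<^sub>2\<close>. But an
  element of \<open>U\<^sub>2\<close> stabilizing \<open>O\<close> fixes a point opposite \<open>p\<close> and is therefore trivial. Thus
  \<open>[U\<^sub>1, U\<^sub>3] = 1\<close>, which the commutator relations of type F4 rule out, whether \<open>p\<close> corresponds to an
  even or to an odd vertex of the coordinatizing apartment.\<close>

section \<open>Projections, polarities and elations in generalized quadrangles\<close>

definition path5 :: "('v \<Rightarrow> 'v \<Rightarrow> bool) \<Rightarrow> 'v \<Rightarrow> 'v \<Rightarrow> 'v \<Rightarrow> 'v \<Rightarrow> 'v \<Rightarrow> bool" where
  "path5 inc a b c d e \<longleftrightarrow> inc a b \<and> inc b c \<and> inc c d \<and> inc d e \<and> a \<noteq> c \<and> b \<noteq> d \<and> c \<noteq> e"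

text \<open>\<open>a\<close>, \<open>b\<close>, \<open>c\<close> are meant as the inner vertices of
  a root. Naming only these frees root groups from any apartment, so that polarities and
  automorphisms can act on them.\<close>

definition elations :: "'v set \<Rightarrow> 'v set \<Rightarrow> ('v \<Rightarrow> 'v \<Rightarrow> bool) \<Rightarrow> 'v \<Rightarrow> 'v \<Rightarrow> 'v \<Rightarrow> ('v \<Rightarrow> 'v) set" where
  "elations Pt Ln inc a b c =
     {g. automorphism Pt Ln inc g \<and> (\<forall>j\<in>{a, b, c}. \<forall>y. inc j y \<longrightarrow> g y = y)}"

text \<open>The relations among three consecutive root groups that the commutator argument needs,
  expressed through the inner vertices of the three roots.\<close>

definition noncommuting_elations ::
  "'v set \<Rightarrow> 'v set \<Rightarrow> ('v \<Rightarrow> 'v \<Rightarrow> bool) \<Rightarrow> 'v \<Rightarrow> 'v \<Rightarrow> 'v \<Rightarrow> 'v \<Rightarrow> 'v \<Rightarrow> bool" where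
  "noncommuting_elations Pt Ln inc a b c d e \<longleftrightarrow>
     (\<forall>f\<in>elations Pt Ln inc a b c. \<forall>g\<in>elations Pt Ln inc b c d. f \<circ> g = g \<circ> f)
   \<and> (\<forall>f\<in>elations Pt Ln inc b c d. \<forall>g\<in>elations Pt Ln inc b c d. f \<circ> g = g \<circ> f)
   \<and> (\<forall>f\<in>elations Pt Ln inc b c d. \<forall>g\<in>elations Pt Ln inc c d e. f \<circ> g = g \<circ> f)
   \<and> (\<exists>f\<in>elations Pt Ln inc a b c. \<exists>g\<in>elations Pt Ln inc c d e. f \<circ> g \<noteq> g \<circ> f)"

section \<open>Automorphisms and conjugation of elations\<close>

lemma automorphism_comp:
  "automorphism Pt Ln inc f \<Longrightarrow> automorphism Pt Ln inc g \<Longrightarrow> automorphism Pt Ln inc (f \<circ> g)"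
  unfolding automorphism_def by (metis (no_types, lifting) bij_comp comp_apply image_comp)

lemma automorphism_inv:
  assumes "automorphism Pt Ln inc f"
  shows "automorphism Pt Ln inc (inv f)"
proof -
  have b: "bij f" using assms by (simp add: automorphism_def)
  have "inv f ` A = A" if "f ` A = A" for A
    using that b by (metis bij_is_inj image_inv_f_f)
  moreover have "inc (inv f x) (inv f y) \<longleftrightarrow> inc x y" for x y
    using assms b unfolding automorphism_def by (metis bij_inv_eq_iff)
  ultimately show ?thesis
    using assms b by (simp add: automorphism_def bij_imp_bij_inv)
qed

lemma automorphism_inj: "automorphism Pt Ln inc g \<Longrightarrow> g x = g y \<longleftrightarrow> x = y"
  by (auto simp: automorphism_def bij_def inj_eq)

lemma automorphism_inc: "automorphism Pt Ln inc g \<Longrightarrow> inc (g x) (g y) \<longleftrightarrow> inc x y"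
  by (simp add: automorphism_def)

lemma automorphism_Pt: "automorphism Pt Ln inc g \<Longrightarrow> g x \<in> Pt \<longleftrightarrow> x \<in> Pt"
  unfolding automorphism_def bij_def by (metis image_iff inj_eq)

lemma path5_automorphism:
  "automorphism Pt Ln inc g \<Longrightarrow> path5 inc (g a) (g b) (g c) (g d) (g e) \<longleftrightarrow> path5 inc a b c d e"
  by (simp add: path5_def automorphism_inc automorphism_inj)

lemma elations_conjugate:
  assumes h: "automorphism Pt Ln inc h" and g: "g \<in> elations Pt Ln inc a b c"
  shows "h \<circ> g \<circ> inv h \<in> elations Pt Ln inc (h a) (h b) (h c)"
proof -
  have "automorphism Pt Ln inc (h \<circ> g \<circ> inv h)"
    using h g by (auto simp: elations_def intro: automorphism_comp automorphism_inv)
  moreover have "(h \<circ> g \<circ> inv h) y = y" if j: "j \<in> {a, b, c}" and "inc (h j) y" for j y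
  proof -
    have y: "h (inv h y) = y"
      using h by (simp add: automorphism_def bij_def surj_f_inv_f)
    then have "inc j (inv h y)"
      using that automorphism_inc[OF h] by metis
    then show ?thesis
      using g j y by (auto simp: elations_def)
  qed
  ultimately show ?thesis by (auto simp: elations_def)
qed

lemma elations_conjugate_obtain:
  assumes h: "automorphism Pt Ln inc h" and f: "f \<in> elations Pt Ln inc (h a) (h b) (h c)"
  obtains f' where "f' \<in> elations Pt Ln inc a b c" "f = h \<circ> f' \<circ> inv h"
proof
  have b: "bij h" using h by (simp add: automorphism_def)
  show "inv h \<circ> f \<circ> h \<in> elations Pt Ln inc a b c"
    using elations_conjugate[OF automorphism_inv[OF h] f] b
    by (simp add: inv_inv_eq inv_f_f bij_is_inj)
  show "f = h \<circ> (inv h \<circ> f \<circ> h) \<circ> inv h"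
    using b by (simp add: fun_eq_iff bij_is_surj surj_f_inv_f)
qed

lemma conjugate_commute:
  assumes "bij h"
  shows "(h \<circ> f \<circ> inv h) \<circ> (h \<circ> g \<circ> inv h) = (h \<circ> g \<circ> inv h) \<circ> (h \<circ> f \<circ> inv h) \<longleftrightarrow> f \<circ> g = g \<circ> f"
proof -
  have 1: "(h \<circ> f \<circ> inv h) \<circ> (h \<circ> g \<circ> inv h) = h \<circ> (f \<circ> g) \<circ> inv h" for f g
    using assms by (simp add: fun_eq_iff bij_is_inj)
  have "f' = g'" if "h \<circ> f' \<circ> inv h = h \<circ> g' \<circ> inv h" for f' g'
  proof
    fix x
    show "f' x = g' x"
      using fun_cong[OF that, of "h x"] assms by (simp add: bij_is_inj inj_eq)
  qed
  then show ?thesis unfolding 1 by metis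
qed

text \<open>Conjugation by \<open>h\<close> carries the elations of a path onto those of its image
  and respects commuting. This moves the relations from the coordinatizing apartment to other
  paths.\<close>

lemma noncommuting_elations_automorphism:
  assumes h: "automorphism Pt Ln inc h" and n: "noncommuting_elations Pt Ln inc a b c d e"
  shows "noncommuting_elations Pt Ln inc (h a) (h b) (h c) (h d) (h e)"
proof -
  have b: "bij h" using h by (simp add: automorphism_def)
  have transfer: "f \<circ> g = g \<circ> f"
    if "f \<in> elations Pt Ln inc (h i) (h j) (h k)" "g \<in> elations Pt Ln inc (h i') (h j') (h k')"
      and c: "\<forall>f\<in>elations Pt Ln inc i j k. \<forall>g\<in>elations Pt Ln inc i' j' k'. f \<circ> g = g \<circ> f"
    for f g i j k i' j' k'
    using elations_conjugate_obtain[OF h that(1)] elations_conjugate_obtain[OF h that(2)] c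
    by (metis conjugate_commute[OF b])
  have "\<exists>f\<in>elations Pt Ln inc (h a) (h b) (h c). \<exists>g\<in>elations Pt Ln inc (h c) (h d) (h e). f \<circ> g \<noteq> g \<circ> f"
    using n unfolding noncommuting_elations_def
    by (metis conjugate_commute[OF b] elations_conjugate[OF h])
  then show ?thesis
    using n unfolding noncommuting_elations_def by (blast intro: transfer)
qed

section \<open>Type-free incidence and short cycles\<close>

context generalized_quadrangle
begin

lemma inc_type_neq: "inc x y \<Longrightarrow> x \<in> Pt \<longleftrightarrow> y \<notin> Pt"
  using inc_type[of x y] Pt_Ln by blast

text \<open>Two lines sharing two points would be two joins of these points, so
  \<open>linear\<close> implies its own dual.\<close>

lemma unique_join:
  assumes "inc x a" "inc y a" "inc x b" "inc y b" "x \<noteq> y"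
  shows "a = b"
proof (cases "x \<in> Pt")
  case True
  then show ?thesis using assms linear inc_type_neq by metis
next
  case False
  then have "a \<in> Pt" "b \<in> Pt" using assms inc_type_neq by blast+
  then show ?thesis using assms linear[of a b x y] inc_sym by blast
qed

lemma projection_ex:
  assumes "x \<in> Pt \<longleftrightarrow> y \<notin> Pt" "\<not> inc x y"
  obtains v z where "inc x v" "inc v z" "inc z y"
proof (cases "x \<in> Pt")
  case True
  then have "y \<in> Ln" using assms Pt_Ln by blast
  then show ?thesis using projection[OF True _ assms(2)] that inc_sym by blast
next
  case False
  then have "x \<in> Ln" "y \<in> Pt" "\<not> inc y x" using assms Pt_Ln inc_sym by blast+
  then show ?thesis using projection[of y x] that inc_sym by blast
qed

lemma projection_unique:
  assumes "\<not> inc x y" "inc x v" "inc v z" "inc z y" "inc x v'" "inc v' z'" "inc z' y"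
  shows "v = v'" "z = z'"
proof -
  have t: "x \<in> Pt \<longleftrightarrow> y \<notin> Pt" using assms inc_type_neq by blast
  have "v = v' \<and> z = z'"
  proof (cases "x \<in> Pt")
    case True
    then have "y \<in> Ln" using t Pt_Ln by blast
    then have "\<exists>!(q, m). inc x m \<and> inc q m \<and> inc q y"
      using projection True assms by blast
    then show ?thesis using assms inc_sym by blast
  next
    case False
    then have "x \<in> Ln" "y \<in> Pt" "\<not> inc y x" using assms t Pt_Ln inc_sym by blast+
    then have "\<exists>!(q, m). inc y m \<and> inc q m \<and> inc q x"
      using projection by blast
    then show ?thesis using assms inc_sym by blast
  qed
  then show "v = v'" "z = z'" by auto
qed

lemma other_neighbour: obtains y where "inc x y" "y \<noteq> a" "y \<noteq> b"
proof -
  obtain A where A: "A \<subseteq> {y. inc x y}" "card A = 3" using thick by blast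
  have "\<not> A \<subseteq> {a, b}"
  proof
    assume "A \<subseteq> {a, b}"
    then have "card A \<le> card {a, b}" by (intro card_mono) auto
    also have "\<dots> \<le> 2" by (simp add: card_insert_if)
    finally show False using A by simp
  qed
  then show ?thesis using A that by blast
qed

lemma no_quadrangle:
  assumes "inc a b" "inc b c" "inc c d" "a \<noteq> c" "b \<noteq> d"
  shows "\<not> inc a d"
  using assms unique_join inc_sym by metis

text \<open>Otherwise \<open>b\<close>, \<open>c\<close> and \<open>f\<close>, \<open>e\<close>
  would be two projection paths from \<open>a\<close> to \<open>d\<close>, which are not incident by
  \<open>no_quadrangle\<close>.\<close>

lemma no_hexagon:
  assumes "path5 inc a b c d e" "inc e f" "d \<noteq> f"
  shows "\<not> inc a f"
proof
  assume "inc a f"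
  then show False
    using assms no_quadrangle[of a b c d] projection_unique[of a d b c f e] inc_sym
    unfolding path5_def by blast
qed

subsection \<open>Polarities\<close>

lemma polarity_simps:
  assumes "polarity Pt Ln inc \<rho>"
  shows "\<rho> (\<rho> x) = x" "\<rho> x = \<rho> y \<longleftrightarrow> x = y" "inc (\<rho> x) (\<rho> y) \<longleftrightarrow> inc x y"
    "\<rho> x \<in> Pt \<longleftrightarrow> x \<notin> Pt"
proof -
  have inv: "\<rho> (\<rho> x) = x" for x
    using assms by (metis polarity_def comp_apply id_apply)
  then show "\<rho> (\<rho> x) = x" "\<rho> x = \<rho> y \<longleftrightarrow> x = y" by metis+
  have "inc x y \<Longrightarrow> inc (\<rho> x) (\<rho> y)" for x y
    using assms by (simp add: polarity_def)
  from this[of x y] this[of "\<rho> x" "\<rho> y"] show "inc (\<rho> x) (\<rho> y) \<longleftrightarrow> inc x y"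
    by (auto simp: inv)
  have "\<rho> ` Pt = Ln" "\<rho> ` Ln = Pt"
    using assms by (simp_all add: polarity_def)
  then have "x \<in> Pt \<Longrightarrow> \<rho> x \<in> Ln" "x \<in> Ln \<Longrightarrow> \<rho> x \<in> Pt" by auto
  moreover have "y \<in> Ln \<longleftrightarrow> y \<notin> Pt" for y using Pt_Ln by auto
  ultimately show "\<rho> x \<in> Pt \<longleftrightarrow> x \<notin> Pt" by auto
qed

text \<open>Two absolute points of \<open>l\<close> would close the hexagon \<open>p\<close>,
  \<open>\<rho> p\<close>, \<open>\<rho> l\<close>, \<open>\<rho> q\<close>, \<open>q\<close>,
  \<open>l\<close>.\<close>

lemma absolute_point_unique:
  assumes r: "polarity Pt Ln inc \<rho>"
    and "p \<in> absolute_points Pt inc \<rho>" "q \<in> absolute_points Pt inc \<rho>" "inc p l" "inc q l"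
  shows "p = q"
proof (rule ccontr)
  assume ne: "p \<noteq> q"
  have p: "inc p (\<rho> p)" "inc (\<rho> p) (\<rho> l)" and q: "inc q (\<rho> q)" "inc (\<rho> q) (\<rho> l)"
    using assms by (auto simp: absolute_points_def polarity_simps[OF r])
  \<comment> \<open>If \<open>x = \<rho> l\<close>, then \<open>l\<close> and
    \<open>\<rho> y\<close> both join \<open>x\<close> to \<open>y\<close>, so
    \<open>l = \<rho> y\<close> and hence \<open>x = y\<close>.\<close>
  have neq: "x \<noteq> \<rho> l"
    if "inc x l" "inc y l" "inc y (\<rho> y)" "inc (\<rho> y) (\<rho> l)" "x \<noteq> y" for x y
    using that unique_join[of x l y "\<rho> y"] inc_sym polarity_simps[OF r] by metis
  have "p \<noteq> \<rho> l" "q \<noteq> \<rho> l" using neq assms p q ne by metis+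
  then have "path5 inc p (\<rho> p) (\<rho> l) (\<rho> q) q" "\<rho> q \<noteq> l"
    using p q ne inc_sym polarity_simps[OF r] unfolding path5_def by metis+
  then show False using no_hexagon assms(4,5) by blast
qed

text \<open>If \<open>\<rho> l\<close> is not on \<open>l\<close>, the polarity reverses the
  projection path from \<open>\<rho> l\<close> to \<open>l\<close>. By uniqueness it swaps the two
  inner vertices, so the one on \<open>l\<close> is absolute.\<close>

lemma absolute_point_exists:
  assumes r: "polarity Pt Ln inc \<rho>" and l: "l \<notin> Pt"
  obtains p where "p \<in> absolute_points Pt inc \<rho>" "inc p l"
proof (cases "inc (\<rho> l) l")
  case True
  then show ?thesis
    using that[of "\<rho> l"] l by (simp add: absolute_points_def polarity_simps[OF r])
next
  case False
  obtain m q where mq: "inc (\<rho> l) m" "inc m q" "inc q l"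
    using projection_ex[of "\<rho> l" l] False l polarity_simps[OF r] by metis
  then have "inc (\<rho> l) (\<rho> q)" "inc (\<rho> q) (\<rho> m)" "inc (\<rho> m) l"
    using inc_sym polarity_simps[OF r] by metis+
  then have "m = \<rho> q" using projection_unique False mq by blast
  then have "inc q (\<rho> q)" using mq inc_sym by blast
  moreover have "q \<in> Pt" using mq l inc_type_neq by blast
  ultimately show ?thesis using that mq by (auto simp: absolute_points_def)
qed

text \<open>A line \<open>m \<noteq> \<rho> p\<close> through \<open>p\<close> is the projection onto \<open>p\<close> of some absolute line \<open>\<rho> w\<close>.\<close>

lemma absolute_point_opposite:
  assumes r: "polarity Pt Ln inc \<rho>" and p: "p \<in> absolute_points Pt inc \<rho>"
    and m: "inc p m" "m \<noteq> \<rho> p"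
  obtains w n where "w \<in> absolute_points Pt inc \<rho>" "inc w n" "inc n (\<rho> m)" "n \<noteq> \<rho> p"
    "inc (\<rho> n) m" "inc (\<rho> n) (\<rho> w)" "w \<noteq> \<rho> m" "w \<noteq> p"
proof -
  have pP: "p \<in> Pt" "inc p (\<rho> p)" using p by (auto simp: absolute_points_def)
  have s: "inc (\<rho> p) (\<rho> m)" using m by (simp add: polarity_simps[OF r])
  have sp: "\<rho> m \<noteq> p" using m polarity_simps[OF r] by metis
  \<comment> \<open>Any such \<open>n\<close> serves: \<open>\<rho>\<close> maps the path
    \<open>w\<close>, \<open>n\<close>, \<open>\<rho> m\<close> to \<open>\<rho> w\<close>,
    \<open>\<rho> n\<close>, \<open>m\<close>.\<close>
  obtain n where n: "inc (\<rho> m) n" "n \<noteq> \<rho> p" using other_neighbour by metis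
  have "m \<notin> Pt" using m pP inc_type_neq by blast
  then have "n \<notin> Pt" using n inc_type_neq polarity_simps(4)[OF r] by blast
  then obtain w where w: "w \<in> absolute_points Pt inc \<rho>" "inc w n"
    using absolute_point_exists[OF r] by blast
  have "w \<noteq> \<rho> m"
    using absolute_point_unique[OF r p w(1) pP(2)] s sp inc_sym by blast
  moreover have "w \<noteq> p"
    using unique_join[of p n "\<rho> m" "\<rho> p"] n s sp w pP inc_sym by blast
  moreover have "inc (\<rho> n) m" "inc (\<rho> n) (\<rho> w)"
    using n w inc_sym polarity_simps[OF r] by metis+
  ultimately show ?thesis using that w n inc_sym by blast
qed

text \<open>A line \<open>m\<close> through an absolute point \<open>p\<close> is either
  \<open>\<rho> p\<close> or the first step of the projection path from \<open>p\<close> to some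
  \<open>\<rho> w\<close> with \<open>w\<close> absolute; both polarities agree at \<open>p\<close>
  and \<open>w\<close>. Points reduce to lines by involutivity.\<close>

lemma polarity_eqI:
  assumes r: "polarity Pt Ln inc \<rho>" and r': "polarity Pt Ln inc \<rho>'"
    and eq: "absolute_points Pt inc \<rho>' = absolute_points Pt inc \<rho>"
    and agree: "\<And>p. p \<in> absolute_points Pt inc \<rho> \<Longrightarrow> \<rho>' p = \<rho> p"
  shows "\<rho>' = \<rho>"
proof -
  have line: "\<rho>' m = \<rho> m" if mP: "m \<notin> Pt" for m
  proof -
    obtain p where p: "p \<in> absolute_points Pt inc \<rho>" "inc p m"
      using absolute_point_exists[OF r mP] by blast
    show ?thesis
    proof (cases "m = \<rho> p")
      case True
      then show ?thesis using agree[OF p(1)] polarity_simps[OF r] polarity_simps[OF r'] by metis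
    next
      case False
      then obtain w n where w: "w \<in> absolute_points Pt inc \<rho>" "inc w n" "inc n (\<rho> m)" "n \<noteq> \<rho> p"
        "inc (\<rho> n) m" "inc (\<rho> n) (\<rho> w)" "w \<noteq> \<rho> m" "w \<noteq> p"
        using absolute_point_opposite[OF r p] by metis
      have "inc w (\<rho> w)" using w by (simp add: absolute_points_def)
      then have pw: "\<not> inc p (\<rho> w)"
        using absolute_point_unique[OF r p(1) w(1)] w by blast
      \<comment> \<open>\<open>\<rho>'\<close> sends the path \<open>\<rho> p\<close>,
        \<open>\<rho> m\<close>, \<open>n\<close>, \<open>w\<close> to a projection path from
        \<open>p\<close> to \<open>\<rho> w\<close>, whose first step must be
        \<open>m\<close>.\<close>
      have "inc p (\<rho>' (\<rho> m))"
      proof -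
        have "inc (\<rho> p) (\<rho> m)" using p by (simp add: polarity_simps[OF r])
        then have "inc (\<rho>' (\<rho> p)) (\<rho>' (\<rho> m))" by (simp add: polarity_simps[OF r'])
        then show ?thesis using agree[OF p(1)] polarity_simps[OF r'] by metis
      qed
      moreover have "inc (\<rho>' (\<rho> m)) (\<rho>' n)"
        using w inc_sym by (simp add: polarity_simps[OF r'])
      moreover have "inc (\<rho>' n) (\<rho> w)"
        using w inc_sym agree[OF w(1)] polarity_simps[OF r'] by metis
      ultimately have "\<rho>' (\<rho> m) = m"
        using projection_unique(1)[OF pw] p w inc_sym by blast
      then show ?thesis using polarity_simps[OF r'] by metis
    qed
  qed
  show ?thesis
  proof
    fix y
    show "\<rho>' y = \<rho> y"
    proof (cases "y \<in> Pt")
      case True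
      then show ?thesis
        using line[of "\<rho> y"] polarity_simps[OF r] polarity_simps[OF r'] by metis
    qed (rule line)
  qed
qed

subsection \<open>Elations\<close>

lemma automorphism_fixes_join:
  assumes "automorphism Pt Ln inc g" "g x = x" "g y = y" "x \<noteq> y" "inc x l" "inc y l"
  shows "g l = l"
  using assms unique_join automorphism_inc by metis

lemma automorphism_fixes_projection:
  assumes "automorphism Pt Ln inc g" "g x = x" "g y = y" "\<not> inc x y"
    "inc x v" "inc v z" "inc z y"
  shows "g v = v" "g z = z"
  using assms projection_unique[of x y v z "g v" "g z"] automorphism_inc[OF assms(1)] by metis+

text \<open>Starting from the points of \<open>m\<close> and \<open>l\<close>, the lines through
  \<open>p\<close> and the point \<open>w\<close>, fixedness spreads to all points collinear with
  \<open>p\<close>, then to all lines through \<open>w\<close> and their points, and finally to all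
  lines.\<close>

lemma elation_fixing_opposite:
  assumes c: "c \<in> elations Pt Ln inc m p l" and pP: "p \<in> Pt"
    and inc: "inc p m" "inc p l" "m \<noteq> l"
    and w: "w \<in> Pt" "c w = w" "\<And>k. inc p k \<Longrightarrow> \<not> inc w k"
  shows "c = id"
proof -
  have aut: "automorphism Pt Ln inc c" using c by (simp add: elations_def)
  note fix_join = automorphism_fixes_join[OF aut] and fix_proj = automorphism_fixes_projection[OF aut]
  have fm: "c y = y" if "inc m y" for y using c that by (simp add: elations_def)
  have fl: "c y = y" if "inc l y" for y using c that by (simp add: elations_def)
  have fp: "c y = y" if "inc p y" for y using c that by (simp add: elations_def)
  have p: "c p = p" using fm inc inc_sym by blast
  \<comment> \<open>If the pointwise fixed line \<open>h\<close> misses the fixed line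
    \<open>k\<close>, project \<open>a\<close> to a point \<open>b\<close> of \<open>h\<close>; in
    turn, \<open>a\<close> is the projection of the fixed point \<open>b\<close> onto
    \<open>k\<close>.\<close>
  have spread: "c a = a"
    if s: "inc a k" "a \<in> Pt" "c k = k" "h \<notin> Pt" "\<And>b. inc h b \<Longrightarrow> c b = b"
      "\<And>b. inc b k \<Longrightarrow> \<not> inc b h" for a k h
  proof -
    have "\<not> inc a h" using that by blast
    then obtain v b where v: "inc a v" "inc v b" "inc b h"
      using projection_ex[of a h] s(2,4) by blast
    then have "\<not> inc b k" "c b = b" using s(5,6) inc_sym by blast+
    then show ?thesis
      using fix_proj(2)[of b k v a] s(1,3) v inc_sym by blast
  qed
  have mP: "m \<notin> Pt" and lP: "l \<notin> Pt" using inc pP inc_type_neq by blast+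
  \<comment> \<open>The line \<open>n\<close> is fixed as the join of \<open>w\<close> and
    \<open>t\<close>, and \<open>m\<close> is the only line through \<open>p\<close> meeting it. So
    \<open>l\<close> fixes the points of \<open>n\<close> via \<open>spread\<close>, and
    \<open>n\<close> those of the remaining lines through \<open>p\<close>.\<close>
  obtain n t where n: "inc w n" "inc n t" "inc t m"
    using projection_ex[of w m] w(1,3) mP inc(1) by metis
  have nP: "n \<notin> Pt" using n w inc_type_neq by blast
  have t: "c t = t" using fm n inc_sym by blast
  have "t \<noteq> w" using n w(3) inc by blast
  then have fn: "c n = n" using fix_join[of t w] t w n inc_sym by blast
  have np: "\<not> inc p n" using n w(3) by blast
  have meet_n: "k = m" if "inc p k" "inc b k" "inc b n" for k b
    using projection_unique(1)[OF np, of k b m t] that n inc inc_sym by blast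
  have pts_n: "c b = b" if "inc n b" for b
    using spread[of b n l] that fn lP fl nP inc_type_neq inc_sym meet_n inc fp by metis
  have p_perp: "c a = a" if "inc p k" "inc k a" for k a
  proof (cases "k = m")
    case True then show ?thesis using fm that by blast
  next
    case False
    have "a \<in> Pt" using that pP inc_type_neq by blast
    then show ?thesis
      using spread[of a k n] that fp nP pts_n meet_n False inc_sym by blast
  qed
  have w_lines: "c h = h" if "inc w h" for h
  proof -
    have "\<not> inc p h" "h \<notin> Pt" using that w inc_type_neq by blast+
    then obtain k a where "inc p k" "inc k a" "inc a h"
      using projection_ex[of p h] pP by metis
    then show ?thesis
      using fix_join[of a w h] p_perp that w inc_sym by blast
  qed
  have w_perp: "c a = a" if h: "inc w h" and a: "inc h a" for h a
  proof -
    have ph: "\<not> inc p h" "h \<notin> Pt" using that w inc_type_neq by blast+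
    then obtain k b where k: "inc p k" "inc k b" "inc b h"
      using projection_ex[of p h] pP by metis
    \<comment> \<open>\<open>k\<close> is the only line through \<open>p\<close> meeting
      \<open>h\<close>, so \<open>k'\<close> misses \<open>h\<close>.\<close>
    obtain k' where k': "inc p k'" "k' \<noteq> k" using other_neighbour by metis
    have "\<not> inc b' k'" if "inc b' h" for b'
      using projection_unique(1)[OF ph(1), of k b k' b'] k k' that inc_sym by blast
    moreover have "k' \<notin> Pt" "a \<in> Pt" using k' pP a ph inc_type_neq by blast+
    ultimately show ?thesis
      using spread[of a h k'] w_lines[OF h] a p_perp[OF k'(1)] inc_sym by blast
  qed
  \<comment> \<open>Besides \<open>a\<close>, such a line contains the projection \<open>b\<close>
    of \<open>w\<close>, a second fixed point.\<close>
  have two: "c g = g" if s: "inc p k" "inc k a" "inc a g" "\<And>h. inc w h \<Longrightarrow> \<not> inc a h" "g \<notin> Pt" for g k a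
  proof -
    have "\<not> inc w g" using s(3,4) inc_sym by blast
    then obtain h b where b: "inc w h" "inc h b" "inc b g"
      using projection_ex[of w g] w(1) s(5) by blast
    then have "a \<noteq> b" using s(4) inc_sym by blast
    then show ?thesis
      using fix_join[of a b g] p_perp[OF s(1,2)] w_perp[OF b(1,2)] s(3) b(3) by blast
  qed
  have lines: "c g = g" if gP: "g \<notin> Pt" for g
  proof (cases "inc p g")
    case True then show ?thesis by (rule fp)
  next
    case pg: False
    then obtain k a where k: "inc p k" "inc k a" "inc a g"
      using projection_ex[of p g] pP gP by metis
    show ?thesis
    proof (cases "\<exists>h. inc w h \<and> inc a h")
      case False then show ?thesis using two[OF k _ gP] by blast
    next
      case True
      \<comment> \<open>Here \<open>p\<close> and \<open>w\<close> have the same projection \<open>a\<close> onto \<open>g\<close>, so \<open>g\<close> is instead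
        recovered from a fixed line \<open>g'\<close> through a point \<open>b\<close> collinear with \<open>p\<close> but not with \<open>w\<close>.\<close>
      obtain k' where k': "inc p k'" "k' \<noteq> k" using other_neighbour by metis
      have "\<not> inc w k'" using w k' by blast
      moreover have k'P: "k' \<notin> Pt" using k' pP inc_type_neq by blast
      ultimately obtain h0 b0 where b0: "inc w h0" "inc h0 b0" "inc b0 k'"
        using projection_ex[of w k'] w by metis
      obtain b where b: "inc k' b" "b \<noteq> p" "b \<noteq> b0" using other_neighbour by metis
      have nb: "\<not> inc b h" if "inc w h" for h
        using projection_unique(2)[OF \<open>\<not> inc w k'\<close> that _ _ b0] b that inc_sym by blast
      have bP: "b \<in> Pt" using b k'P inc_type_neq by blast
      have ap: "a \<noteq> p" using pg k by blast
      \<comment> \<open>A line through \<open>a\<close> and \<open>b\<close> would form a triangle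
        with \<open>p\<close>.\<close>
      have ab: "\<not> (inc a h \<and> inc b h)" for h
      proof
        assume h: "inc a h \<and> inc b h"
        have "h \<noteq> k'" using h k k' ap unique_join[of a k p k'] inc_sym by blast
        moreover have "a \<noteq> b" using k k' b unique_join[of b k p k'] inc_sym by blast
        moreover have "h \<noteq> k" using k k' b h unique_join[of b k p k'] inc_sym by blast
        ultimately show False
          using no_hexagon[of a k p k' b h] h k k' b ap inc_sym unfolding path5_def by blast
      qed
      have "\<not> inc b g" using ab k by blast
      then obtain g' e where g': "inc b g'" "inc g' e" "inc e g"
        using projection_ex[of b g] bP gP by metis
      have g'P: "g' \<notin> Pt" using g' bP inc_type_neq by blast
      have "c g' = g'" using two[OF k'(1) b(1) g'(1) nb g'P] by blast
      moreover have "\<not> inc a g'" using ab g' by blast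
      ultimately show ?thesis
        using fix_proj(1)[of a g' g e] p_perp[OF k(1,2)] k g' inc_sym by blast
    qed
  qed
  have "c y = y" for y
  proof (cases "y \<in> Pt")
    case True
    obtain g where g: "inc y g" using other_neighbour by metis
    obtain h where h: "inc y h" "h \<noteq> g" using other_neighbour by metis
    show ?thesis
      using fix_join[of g h y] g h lines True inc_type_neq inc_sym by metis
  qed (rule lines)
  then show ?thesis by auto
qed

text \<open>The absolute point \<open>w\<close> opposite \<open>p\<close> built from
  \<open>m\<close> lies on a line \<open>n\<close> through a fixed point; stability of the absolute
  points forces \<open>c\<close> to fix first \<open>n\<close>, then \<open>w\<close>.\<close>

lemma automorphism_fixing_polarity_elation:
  assumes r: "polarity Pt Ln inc \<rho>" and p: "p \<in> absolute_points Pt inc \<rho>"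
    and m: "inc p m" "m \<noteq> \<rho> p" and c: "c \<in> elations Pt Ln inc m p (\<rho> p)"
    and stable: "\<And>w. w \<in> absolute_points Pt inc \<rho> \<Longrightarrow> c w \<in> absolute_points Pt inc \<rho>"
  shows "c = id"
proof -
  have aut: "automorphism Pt Ln inc c" using c by (simp add: elations_def)
  have pP: "p \<in> Pt" "inc p (\<rho> p)" using p by (auto simp: absolute_points_def)
  obtain w n where w: "w \<in> absolute_points Pt inc \<rho>" "inc w n" "inc n (\<rho> m)" "n \<noteq> \<rho> p"
    "inc (\<rho> n) m" "inc (\<rho> n) (\<rho> w)" "w \<noteq> \<rho> m" "w \<noteq> p"
    using absolute_point_opposite[OF r p m] by metis
  have wP: "w \<in> Pt" "inc w (\<rho> w)" using w by (auto simp: absolute_points_def)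
  have s: "inc (\<rho> p) (\<rho> m)" using m by (simp add: polarity_simps[OF r])
  have sp: "\<rho> m \<noteq> p" using m polarity_simps[OF r] by metis
  have nP: "n \<notin> Pt" using w wP inc_type_neq by blast
  have pn: "\<not> inc p n" using unique_join[of p n "\<rho> m" "\<rho> p"] w s sp pP inc_sym by blast
  \<comment> \<open>Projecting \<open>p\<close> onto \<open>n\<close> gives
    \<open>k = \<rho> p\<close>, and then \<open>n\<close> and \<open>\<rho> p\<close> would share
    both \<open>w\<close> and \<open>\<rho> m\<close>.\<close>
  have opp: "\<not> inc w k" if k: "inc p k" for k
  proof
    assume wk: "inc w k"
    have "k = \<rho> p"
      using projection_unique(1)[OF pn, of k w "\<rho> p" "\<rho> m"] k wk w s pP inc_sym by blast
    then show False using unique_join[of w n "\<rho> m" "\<rho> p"] wk w s inc_sym by blast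
  qed
  have cs: "c (\<rho> m) = \<rho> m" using c s by (simp add: elations_def)
  have ct: "c (\<rho> n) = \<rho> n" using c w(5) inc_sym by (simp add: elations_def)
  have q: "c w \<in> absolute_points Pt inc \<rho>" by (rule stable[OF w(1)])
  have qn: "inc (c w) (c n)" using w by (simp add: automorphism_inc[OF aut])
  \<comment> \<open>Two projection paths from \<open>c w\<close> to \<open>m\<close> are compared:
    one runs through \<open>\<rho> (c w)\<close> and \<open>\<rho> (c n)\<close>, the other is the
    image under \<open>c\<close> of the path through \<open>\<rho> w\<close> and
    \<open>\<rho> n\<close>.\<close>
  have "inc (c n) (c (\<rho> m))" using w by (simp add: automorphism_inc[OF aut])
  then have "inc (\<rho> (c n)) m" using cs polarity_simps[OF r] by metis
  moreover have "inc (c w) (\<rho> (c w))" using q by (simp add: absolute_points_def)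
  moreover have "inc (\<rho> (c w)) (\<rho> (c n))" using qn by (simp add: polarity_simps[OF r])
  moreover have cwm: "\<not> inc (c w) m"
  proof
    assume "inc (c w) m"
    moreover have "c m = m" using c m by (simp add: elations_def)
    ultimately have "inc w m" using automorphism_inc[OF aut, of w m] by simp
    then show False using opp m by blast
  qed
  moreover have "inc (c w) (c (\<rho> w))" "inc (c (\<rho> w)) (\<rho> n)"
    using automorphism_inc[OF aut] wP w(6) ct inc_sym by metis+
  ultimately have "\<rho> (c n) = \<rho> n"
    using projection_unique(2)[OF cwm] w(5) by blast
  then have "c n = n" by (simp add: polarity_simps[OF r])
  then have "c w = w" using absolute_point_unique[OF r q w(1)] qn w(2) by simp
  then show ?thesis
    using elation_fixing_opposite[OF c pP(1) m(1) pP(2) m(2) wP(1)] opp by blast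
qed

lemma polarity_elation:
  assumes r: "polarity Pt Ln inc \<rho>" and u: "u \<in> elations Pt Ln inc a b c"
  shows "\<rho> \<circ> u \<circ> \<rho> \<in> elations Pt Ln inc (\<rho> a) (\<rho> b) (\<rho> c)"
proof -
  have aut: "automorphism Pt Ln inc u" using u by (simp add: elations_def)
  have inv: "\<rho> \<circ> \<rho> = id" using r by (simp add: polarity_def)
  have "bij \<rho>" using o_bij[OF inv inv] .
  then have "bij (\<rho> \<circ> u \<circ> \<rho>)" using aut by (simp add: automorphism_def bij_comp)
  moreover have "(\<rho> \<circ> u \<circ> \<rho>) ` Pt = Pt" "(\<rho> \<circ> u \<circ> \<rho>) ` Ln = Ln"
    using r aut by (simp_all add: polarity_def automorphism_def image_comp[symmetric] del: o_apply)
  ultimately have "automorphism Pt Ln inc (\<rho> \<circ> u \<circ> \<rho>)"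
    using automorphism_inc[OF aut] by (simp add: automorphism_def polarity_simps[OF r])
  moreover have "\<rho> (u (\<rho> y)) = y" if "j \<in> {a, b, c}" "inc (\<rho> j) y" for j y
  proof -
    have "inc j (\<rho> y)" using that polarity_simps[OF r] by metis
    then have "u (\<rho> y) = \<rho> y" using that u by (auto simp: elations_def)
    then show ?thesis by (simp add: polarity_simps[OF r])
  qed
  ultimately show ?thesis by (auto simp: elations_def)
qed

lemma centralizer_stabilizes_absolute_points:
  assumes r: "polarity Pt Ln inc \<rho>" and z: "automorphism Pt Ln inc z"
    and comm: "\<And>y. \<rho> (z y) = z (\<rho> y)"
  shows "z y \<in> absolute_points Pt inc \<rho> \<longleftrightarrow> y \<in> absolute_points Pt inc \<rho>"
  using automorphism_inc[OF z] automorphism_Pt[OF z] by (simp add: absolute_points_def comm)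

lemma polarities_agree_on_absolute_points:
  assumes r: "polarity Pt Ln inc \<rho>" and r': "polarity Pt Ln inc \<rho>'"
    and eq: "absolute_points Pt inc \<rho>' = absolute_points Pt inc \<rho>"
    and nc: "\<And>a b c d e. path5 inc a b c d e \<Longrightarrow> a \<in> Pt \<Longrightarrow> noncommuting_elations Pt Ln inc a b c d e"
    and p: "p \<in> absolute_points Pt inc \<rho>"
  shows "\<rho>' p = \<rho> p"
proof (rule ccontr)
  assume ne: "\<rho>' p \<noteq> \<rho> p"
  note R = polarity_simps[OF r] and R' = polarity_simps[OF r']
  define m l where "m = \<rho>' p" and "l = \<rho> p"
  have p': "p \<in> absolute_points Pt inc \<rho>'" using p eq by simp
  have pP: "p \<in> Pt" "inc p l" "inc p m" using p p' by (auto simp: absolute_points_def m_def l_def)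
  have "inc (\<rho>' l) m" "inc l (\<rho> m)"
    using pP inc_sym unfolding m_def l_def by (simp_all add: R R')
  moreover have "\<rho>' l \<noteq> p" "\<rho> m \<noteq> p"
    using ne R(1)[of m] R'(1)[of l] unfolding m_def l_def by auto
  ultimately have path: "path5 inc (\<rho>' l) m p l (\<rho> m)"
    using pP(2) inc_sym[OF pP(3)] ne unfolding path5_def m_def l_def by auto
  have "\<rho>' l \<in> Pt" using pP(1,2) inc_type_neq[of p l] R'(4)[of l] by blast
  then have nc: "noncommuting_elations Pt Ln inc (\<rho>' l) m p l (\<rho> m)" using nc path by blast
  let ?U1 = "elations Pt Ln inc (\<rho>' l) m p" and ?U2 = "elations Pt Ln inc m p l"
    and ?U3 = "elations Pt Ln inc p l (\<rho> m)"
  obtain u1 u3 where u: "u1 \<in> ?U1" "u3 \<in> ?U3" "u1 \<circ> u3 \<noteq> u3 \<circ> u1"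
    using nc unfolding noncommuting_elations_def by blast
  have elations_rev: "elations Pt Ln inc a b c = elations Pt Ln inc c b a" for a b c
    by (auto simp: elations_def)
  \<comment> \<open>\<open>\<rho>\<close> swaps \<open>p\<close> with \<open>l\<close> and
    \<open>m\<close> with \<open>\<rho> m\<close>, while \<open>\<rho>'\<close> swaps
    \<open>p\<close> with \<open>m\<close> and \<open>l\<close> with \<open>\<rho>' l\<close>. Both
    conjugates therefore land in \<open>?U2\<close>, up to reversal of the path.\<close>
  define v v' where "v = \<rho> \<circ> u3 \<circ> \<rho>" and "v' = \<rho>' \<circ> u1 \<circ> \<rho>'"
  have v: "v \<in> ?U2"
    using polarity_elation[OF r u(2)] elations_rev unfolding v_def l_def by (simp add: R)
  have v': "v' \<in> ?U2"
    using polarity_elation[OF r' u(1)] elations_rev unfolding v'_def m_def by (simp add: R')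
  have comm: "f (g y) = g (f y)" if "f \<circ> g = g \<circ> f" for f g :: "'a \<Rightarrow> 'a" and y
    using fun_cong[OF that] by simp
  have "u1 \<circ> g = g \<circ> u1" "g \<circ> u3 = u3 \<circ> g" "v' \<circ> g = g \<circ> v'" if "g \<in> ?U2" for g
    using nc u(1,2) v' that unfolding noncommuting_elations_def by blast+
  then have U12: "u1 (g y) = g (u1 y)" and U23: "g (u3 y) = u3 (g y)"
    and U22: "v' (g y) = g (v' y)" if "g \<in> ?U2" for g y
    using that by (simp_all add: comm)
  have aut: "automorphism Pt Ln inc u1" "automorphism Pt Ln inc u3" "automorphism Pt Ln inc v"
    "automorphism Pt Ln inc v'"
    using u v v' by (auto simp: elations_def)
  \<comment> \<open>\<open>\<rho>\<close> interchanges \<open>v\<close> and \<open>u3\<close>, which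
    commute, so it centralizes their product.\<close>
  have "\<rho> (v (u3 y)) = v (u3 (\<rho> y))" for y
  proof -
    have "\<rho> (v y) = u3 (\<rho> y)" and "v (\<rho> y) = \<rho> (u3 y)" for y by (simp_all add: v_def R)
    then show ?thesis using U23[OF v, of "\<rho> y"] by simp
  qed
  then have z: "v (u3 y) \<in> absolute_points Pt inc \<rho> \<longleftrightarrow> y \<in> absolute_points Pt inc \<rho>" for y
    using centralizer_stabilizes_absolute_points[OF r automorphism_comp[OF aut(3,2)], of y] by simp
  have "\<rho>' (v' (u1 y)) = v' (u1 (\<rho>' y))" for y
  proof -
    have "\<rho>' (v' y) = u1 (\<rho>' y)" and "v' (\<rho>' y) = \<rho>' (u1 y)" for y by (simp_all add: v'_def R')
    then show ?thesis using U12[OF v', of "\<rho>' y"] by simp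
  qed
  then have z': "v' (u1 y) \<in> absolute_points Pt inc \<rho> \<longleftrightarrow> y \<in> absolute_points Pt inc \<rho>" for y
    using centralizer_stabilizes_absolute_points[OF r' automorphism_comp[OF aut(4,1)], of y]
    by (simp add: eq)
  \<comment> \<open>This commutator fixes each vertex at which the two orders of \<open>u1\<close>
    and \<open>u3\<close> agree.\<close>
  define c where "c = inv (u1 \<circ> u3) \<circ> (u3 \<circ> u1)"
  have aut13: "automorphism Pt Ln inc (u1 \<circ> u3)" and autc: "automorphism Pt Ln inc c"
    using aut unfolding c_def by (blast intro: automorphism_comp automorphism_inv)+
  have uc: "u1 (u3 (c y)) = u3 (u1 y)" for y
  proof -
    have "(u1 \<circ> u3) (inv (u1 \<circ> u3) (u3 (u1 y))) = u3 (u1 y)"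
      using aut13 unfolding automorphism_def by (metis bij_is_surj surj_f_inv_f)
    then show ?thesis by (simp add: c_def)
  qed
  have cfix: "c y = y" if "u1 (u3 y) = u3 (u1 y)" for y
    using that uc[of y] automorphism_inj[OF aut(1)] automorphism_inj[OF aut(2)] by metis
  have "c y = y" if "inc p y" for y
    using that u by (intro cfix) (simp add: elations_def)
  moreover have "c y = y" if "inc m y" for y
  proof -
    have "u3 m = m" using u pP by (simp add: elations_def)
    then have "inc m (u3 y)" using that automorphism_inc[OF aut(2)] by metis
    then show ?thesis using that u by (intro cfix) (simp add: elations_def)
  qed
  moreover have "c y = y" if "inc l y" for y
  proof -
    have "u1 l = l" using u pP by (simp add: elations_def)
    then have "inc l (u1 y)" using that automorphism_inc[OF aut(1)] by metis
    then show ?thesis using that u by (intro cfix) (simp add: elations_def)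
  qed
  ultimately have c: "c \<in> elations Pt Ln inc m p (\<rho> p)"
    using autc by (auto simp: elations_def l_def)
  have "c w \<in> absolute_points Pt inc \<rho>" if w: "w \<in> absolute_points Pt inc \<rho>" for w
  proof -
    \<comment> \<open>\<open>v\<close> commutes with \<open>u1\<close> and \<open>v'\<close>, and
      \<open>v'\<close> with \<open>u3\<close>, so exchanging the stabilizers \<open>v u3\<close>
      and \<open>v' u1\<close> costs exactly \<open>c\<close>.\<close>
    have "v' (u1 (v (u3 (c w)))) = v (u3 (v' (u1 w)))"
      using U12[OF v] U22[OF v] U23[OF v'] uc by simp
    then show ?thesis using z z' w by metis
  qed
  then have "c = id"
    using automorphism_fixing_polarity_elation[OF r p pP(3) _ c] ne by (simp add: m_def)
  then have "u1 \<circ> u3 = u3 \<circ> u1" using uc by auto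
  then show False using u by blast
qed

end

section \<open>Transitivity of the automorphism group on paths\<close>

context generalized_quadrangle
begin

text \<open>The projection path from \<open>c5\<close> to \<open>c0\<close> closes an octagon.
  Vertices of different types are distinct anyway, and coincidences within a type are excluded by
  the absence of shorter cycles.\<close>

lemma apartment_through_path:
  assumes c: "path5 inc c0 c1 c2 c3 c4" "inc c4 c5" "c3 \<noteq> c5"
  obtains x where "apartment inc x" "x 0 = c0" "x 1 = c1" "x 2 = c2" "x 3 = c3" "x 4 = c4" "x 5 = c5"
proof -
  have i: "inc c0 c1" "inc c1 c2" "inc c2 c3" "inc c3 c4" "c0 \<noteq> c2" "c1 \<noteq> c3" "c2 \<noteq> c4"
    using c by (auto simp: path5_def)
  have t: "c1 \<in> Pt \<longleftrightarrow> c0 \<notin> Pt" "c2 \<in> Pt \<longleftrightarrow> c0 \<in> Pt" "c3 \<in> Pt \<longleftrightarrow> c0 \<notin> Pt"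
    "c4 \<in> Pt \<longleftrightarrow> c0 \<in> Pt" "c5 \<in> Pt \<longleftrightarrow> c0 \<notin> Pt"
    using i c(2) inc_type_neq by blast+
  have n05: "\<not> inc c0 c5" using no_hexagon c by blast
  then obtain c6 c7 where j: "inc c5 c6" "inc c6 c7" "inc c7 c0"
    using projection_ex[of c5 c0] t inc_sym by metis
  have t': "c6 \<in> Pt \<longleftrightarrow> c0 \<in> Pt" "c7 \<in> Pt \<longleftrightarrow> c0 \<notin> Pt"
    using j t inc_type_neq by blast+
  have n03: "\<not> inc c0 c3" and n25: "\<not> inc c2 c5"
    using no_quadrangle[of c0 c1 c2 c3] no_quadrangle[of c2 c3 c4 c5] i c by blast+
  have "c0 \<noteq> c4" using n03 i inc_sym by blast
  moreover have "c1 \<noteq> c5" using n05 i by blast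
  moreover have "c6 \<noteq> c0" "c7 \<noteq> c5" using j n05 inc_sym by blast+
  moreover have "c6 \<noteq> c2" "c7 \<noteq> c3" using j n25 n03 inc_sym by blast+
  moreover have c64: "c6 \<noteq> c4"
    using no_hexagon[OF c(1), of c7] j \<open>c7 \<noteq> c3\<close> inc_sym by blast
  moreover have "c7 \<noteq> c1"
    using no_hexagon[of c1 c2 c3 c4 c5 c6] c64 i c(2,3) j inc_sym unfolding path5_def by blast
  ultimately have d: "distinct [c0, c1, c2, c3, c4, c5, c6, c7]"
    using i c(3) t t' by auto
  define xs where "xs = [c0, c1, c2, c3, c4, c5, c6, c7]"
  define x where "x i = xs ! (i mod 8)" for i
  have "inj_on x {..<8}"
  proof (rule inj_onI)
    fix a b :: nat assume ab: "a \<in> {..<8}" "b \<in> {..<8}" "x a = x b"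
    then have "xs ! a = xs ! b" by (simp add: x_def)
    moreover have "length xs = 8" "distinct xs" using d by (simp_all add: xs_def)
    ultimately show "a = b" using ab by (simp add: nth_eq_iff_index_eq)
  qed
  moreover have "inc (x k) (x (k + 1))" for k
  proof -
    have "k mod 8 < 8" by simp
    then have "k mod 8 \<in> {0, 1, 2, 3, 4, 5, 6, 7}" by auto
    moreover have "(k + 1) mod 8 = (k mod 8 + 1) mod 8" by (simp add: mod_simps)
    ultimately show ?thesis using i c(2) j by (auto simp: x_def xs_def)
  qed
  ultimately have "apartment inc x" by (simp add: apartment_def x_def)
  then show ?thesis using that[of x] by (simp add: x_def xs_def)
qed

end

section \<open>Moving paths by root elations\<close>

context moufang_quadrangle
begin

text \<open>An auxiliary \<open>c0\<close> completes the path to a root; \<open>x\<close> and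
  \<open>y\<close> extend this root to two apartments, which the Moufang condition maps onto each
  other.\<close>

lemma moves_fixing_four:
  assumes c: "inc c1 c2" "inc c2 c3" "inc c3 c4" "c1 \<noteq> c3" "c2 \<noteq> c4"
    and xy: "inc c4 x" "inc c4 y" "x \<noteq> c3" "y \<noteq> c3"
  obtains g where "automorphism Pt Ln inc g" "g c1 = c1" "g c2 = c2" "g c3 = c3" "g c4 = c4" "g x = y"
proof -
  obtain c0 where c0: "inc c1 c0" "c0 \<noteq> c2" using other_neighbour by metis
  then have path: "path5 inc c0 c1 c2 c3 c4" using c inc_sym by (auto simp: path5_def)
  obtain A where A: "apartment inc A" "A 0 = c0" "A 1 = c1" "A 2 = c2" "A 3 = c3" "A 4 = c4" "A 5 = x"
    using apartment_through_path[OF path xy(1)] xy by metis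
  obtain B where B: "apartment inc B" "B 0 = c0" "B 1 = c1" "B 2 = c2" "B 3 = c3" "B 4 = c4" "B 5 = y"
    using apartment_through_path[OF path xy(2)] xy by metis
  have "A i = B i" if "i \<le> 4" for i
  proof -
    have "i \<in> {0, 1, 2, 3, 4}" using that by auto
    then show ?thesis using A B by auto
  qed
  then obtain g where g: "g \<in> root_group Pt Ln inc A 0" "\<forall>i. g (A i) = B i"
    using moufang[OF A(1) B(1)] by blast
  then have "automorphism Pt Ln inc g" by (simp add: root_group_def)
  then show ?thesis using that g(2) A B by metis
qed

lemma moves_fixing_three:
  assumes "inc c2 c3" "inc c3 c4" "c2 \<noteq> c4" "inc c4 x" "inc c4 y" "x \<noteq> c3" "y \<noteq> c3"
  obtains g where "automorphism Pt Ln inc g" "g c2 = c2" "g c3 = c3" "g c4 = c4" "g x = y"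
proof -
  obtain c1 where "inc c2 c1" "c1 \<noteq> c3" using other_neighbour by metis
  then show ?thesis using moves_fixing_four[of c1 c2 c3 c4 x y] assms that inc_sym by metis
qed

lemma moves_fixing_two:
  assumes "inc c3 c4" "inc c4 x" "inc c4 y" "x \<noteq> c3" "y \<noteq> c3"
  obtains g where "automorphism Pt Ln inc g" "g c3 = c3" "g c4 = c4" "g x = y"
proof -
  obtain c2 where "inc c3 c2" "c2 \<noteq> c4" using other_neighbour by metis
  then show ?thesis using moves_fixing_three[of c2 c3 c4 x y] assms that inc_sym by metis
qed

lemma moves_fixing_one:
  assumes "inc v x" "inc v y"
  obtains g where "automorphism Pt Ln inc g" "g v = v" "g x = y"
proof -
  \<comment> \<open>Thickness leaves a neighbour different from both \<open>x\<close> and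
    \<open>y\<close>.\<close>
  obtain c3 where "inc v c3" "c3 \<noteq> x" "c3 \<noteq> y" using other_neighbour by metis
  then show ?thesis using moves_fixing_two[of c3 v x y] assms that inc_sym by metis
qed

text \<open>Vertices with a common neighbour are handled by \<open>moves_fixing_one\<close>; in
  general two such moves, through the projection \<open>z\<close> of \<open>p\<close> onto
  \<open>k\<close>, suffice.\<close>

lemma moves_vertex:
  assumes "p \<in> Pt \<longleftrightarrow> q \<in> Pt"
  obtains g where "automorphism Pt Ln inc g" "g p = q"
proof -
  obtain k where k: "inc q k" using other_neighbour by metis
  show ?thesis
  proof (cases "inc p k")
    case True
    then show ?thesis using moves_fixing_one[of k p q] k that inc_sym by metis
  next
    case False
    have "p \<in> Pt \<longleftrightarrow> k \<notin> Pt" using assms k inc_type_neq by blast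
    then obtain v z where v: "inc p v" "inc v z" "inc z k"
      using projection_ex[of p k] False by metis
    obtain g where g: "automorphism Pt Ln inc g" "g p = z"
      using moves_fixing_one[of v p z] v inc_sym by metis
    obtain h where h: "automorphism Pt Ln inc h" "h z = q"
      using moves_fixing_one[of k z q] v k inc_sym by metis
    show ?thesis using that[of "h \<circ> g"] automorphism_comp[OF h(1) g(1)] g h by simp
  qed
qed

text \<open>The paths are aligned vertex by vertex, each correction fixing the vertices already in
  place.\<close>

lemma path5_transitive:
  assumes c: "path5 inc c0 c1 c2 c3 c4" and d: "path5 inc d0 d1 d2 d3 d4"
    and t: "c0 \<in> Pt \<longleftrightarrow> d0 \<in> Pt"
  obtains g where "automorphism Pt Ln inc g" "g c0 = d0" "g c1 = d1" "g c2 = d2" "g c3 = d3" "g c4 = d4"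
proof -
  have d': "inc d0 d1" "inc d1 d2" "inc d2 d3" "inc d3 d4" "d0 \<noteq> d2" "d1 \<noteq> d3" "d2 \<noteq> d4"
    using d by (auto simp: path5_def)
  have path: "inc (g c0) (g c1)" "inc (g c1) (g c2)" "inc (g c2) (g c3)" "inc (g c3) (g c4)"
    "g c2 \<noteq> g c0" "g c3 \<noteq> g c1" "g c4 \<noteq> g c2" if "automorphism Pt Ln inc g" for g
    using c path5_automorphism[OF that, of c0 c1 c2 c3 c4] by (auto simp: path5_def)
  obtain g0 where g0: "automorphism Pt Ln inc g0" "g0 c0 = d0"
    using moves_vertex[OF t] by metis
  obtain h1 where h1: "automorphism Pt Ln inc h1" "h1 d0 = d0" "h1 (g0 c1) = d1"
    using moves_fixing_one[of d0 "g0 c1" d1] path[OF g0(1)] g0 d' by metis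
  define g1 where "g1 = h1 \<circ> g0"
  have g1: "automorphism Pt Ln inc g1" "g1 c0 = d0" "g1 c1 = d1"
    using automorphism_comp[OF h1(1) g0(1)] g0 h1 by (simp_all add: g1_def)
  obtain h2 where h2: "automorphism Pt Ln inc h2" "h2 d0 = d0" "h2 d1 = d1" "h2 (g1 c2) = d2"
    using moves_fixing_two[of d0 d1 "g1 c2" d2] path[OF g1(1)] g1 d' by metis
  define g2 where "g2 = h2 \<circ> g1"
  have g2: "automorphism Pt Ln inc g2" "g2 c0 = d0" "g2 c1 = d1" "g2 c2 = d2"
    using automorphism_comp[OF h2(1) g1(1)] g1 h2 by (simp_all add: g2_def)
  obtain h3 where h3: "automorphism Pt Ln inc h3" "h3 d0 = d0" "h3 d1 = d1" "h3 d2 = d2"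
    "h3 (g2 c3) = d3"
    using moves_fixing_three[of d0 d1 d2 "g2 c3" d3] path[OF g2(1)] g2 d' by metis
  define g3 where "g3 = h3 \<circ> g2"
  have g3: "automorphism Pt Ln inc g3" "g3 c0 = d0" "g3 c1 = d1" "g3 c2 = d2" "g3 c3 = d3"
    using automorphism_comp[OF h3(1) g2(1)] g2 h3 by (simp_all add: g3_def)
  obtain h4 where h4: "automorphism Pt Ln inc h4" "h4 d0 = d0" "h4 d1 = d1" "h4 d2 = d2"
    "h4 d3 = d3" "h4 (g3 c4) = d4"
    using moves_fixing_four[of d0 d1 d2 d3 "g3 c4" d4] path[OF g3(1)] g3 d' by metis
  show ?thesis
    using that[of "h4 \<circ> g3"] automorphism_comp[OF h4(1) g3(1)] g3 h4 by simp
qed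

end

section \<open>Noncommuting root groups of the quadrangles of type F4\<close>

context F4_data
begin

lemma two_eq_0: "x + x = (0 :: 'f)"
proof -
  have "of_nat CHAR('f) = (0 :: 'f)" by (rule of_nat_CHAR)
  then have "(2 :: 'f) = 0" by (simp add: char_2)
  then show ?thesis by (metis mult_2 mult_zero_left)
qed

lemma bar_simps:
  "bar (x + y) = bar x + bar y" "bar (x * y) = bar x * bar y" "x \<in> K \<Longrightarrow> bar x = x"
  using bar_automorphism by (auto simp: field_automorphism_over_def)

lemma K_simps:
  "0 \<in> K" "1 \<in> K" "x \<in> K \<Longrightarrow> y \<in> K \<Longrightarrow> x + y \<in> K" "x \<in> K \<Longrightarrow> y \<in> K \<Longrightarrow> x * y \<in> K"
  "x \<in> K \<Longrightarrow> - x \<in> K" "x \<in> K \<Longrightarrow> inverse x \<in> K"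
  using subfield_K by (auto simp: is_subfield_def)

lemma K_diff: "x \<in> K \<Longrightarrow> y \<in> K \<Longrightarrow> x - y \<in> K"
  using K_simps(3,5) by (metis diff_conv_add_uminus)

text \<open>As \<open>w\<close> lies outside \<open>K\<close>, \<open>1\<close> and \<open>w\<close>
  form a basis over \<open>K\<close>, in which \<open>w * w\<close> is expanded.\<close>

lemma quadratic_equation:
  assumes "w \<notin> K"
  obtains a b where "a \<in> K" "b \<in> K" "w * w = a * w + b"
proof -
  obtain s t where bij: "bij_betw (\<lambda>(a, b). a * s + b * t) (K \<times> K) UNIV"
    using quadratic by (auto simp: quadratic_over_def)
  have ex: "\<exists>a\<in>K. \<exists>b\<in>K. z = a * s + b * t" for z
  proof -
    have "z \<in> (\<lambda>(a, b). a * s + b * t) ` (K \<times> K)" using bij by (simp add: bij_betw_def)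
    then show ?thesis by auto
  qed
  obtain a1 b1 where 1: "a1 \<in> K" "b1 \<in> K" "1 = a1 * s + b1 * t" using ex by metis
  obtain a2 b2 where 2: "a2 \<in> K" "b2 \<in> K" "w = a2 * s + b2 * t" using ex by metis
  obtain a3 b3 where 3: "a3 \<in> K" "b3 \<in> K" "w * w = a3 * s + b3 * t" using ex by metis
  \<comment> \<open>\<open>D\<close> is the determinant of \<open>1\<close> and \<open>w\<close> in
    the basis \<open>s\<close>, \<open>t\<close>; what follows is Cramer's rule.\<close>
  define D where "D = a1 * b2 - a2 * b1"
  have Ds: "D * s = b2 - b1 * w" and Dt: "D * t = a1 * w - a2"
  proof -
    have "D * s = b2 * (a1 * s + b1 * t) - b1 * (a2 * s + b2 * t)" by (simp add: D_def algebra_simps)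
    then show "D * s = b2 - b1 * w" using 1 2 by simp
    have "D * t = a1 * (a2 * s + b2 * t) - a2 * (a1 * s + b1 * t)" by (simp add: D_def algebra_simps)
    then show "D * t = a1 * w - a2" using 1 2 by simp
  qed
  have DK: "D \<in> K" unfolding D_def using 1 2 by (intro K_diff K_simps(4); simp)
  have "D \<noteq> 0"
  proof
    assume "D = 0"
    then have "b1 * w = b2" "a1 * w = a2" using Ds Dt by auto
    moreover have "a1 \<noteq> 0 \<or> b1 \<noteq> 0" using 1(3) by auto
    ultimately have "w = inverse b1 * b2 \<or> w = inverse a1 * a2" by (auto simp: field_simps)
    then show False using assms 1(1,2) 2(1,2) K_simps(4,6) by metis
  qed
  then have "w * w = inverse D * (D * (w * w))" by simp
  also have "D * (w * w) = a3 * (D * s) + b3 * (D * t)" using 3 by (simp add: algebra_simps)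
  also have "\<dots> = (b3 * a1 - a3 * b1) * w + (a3 * b2 - b3 * a2)"
    unfolding Ds Dt by (simp add: algebra_simps)
  finally have "w * w = (inverse D * (b3 * a1 - a3 * b1)) * w + inverse D * (a3 * b2 - b3 * a2)"
    by (simp add: algebra_simps)
  moreover have "inverse D * (b3 * a1 - a3 * b1) \<in> K" "inverse D * (a3 * b2 - b3 * a2) \<in> K"
    using 1 2 3 DK by (intro K_simps(4,6) K_diff; simp)+
  ultimately show ?thesis using that by blast
qed

text \<open>\<open>w\<close> and \<open>bar w\<close> are distinct roots of one quadratic over
  \<open>K\<close>, so their sum is its linear coefficient; in characteristic 2 a zero sum would
  mean \<open>bar w = w\<close>.\<close>

lemma nonzero_trace:
  obtains w where "w + bar w \<in> K" "w + bar w \<noteq> 0"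
proof -
  obtain w where w: "bar w \<noteq> w" using bar_nontrivial by (auto simp: fun_eq_iff)
  then have "w \<notin> K" using bar_simps by blast
  then obtain a b where ab: "a \<in> K" "b \<in> K" "w * w = a * w + b"
    using quadratic_equation by metis
  have "bar w * bar w = a * bar w + b"
    using arg_cong[OF ab(3), of bar] ab(1,2) by (simp add: bar_simps)
  then have "(w - bar w) * (w + bar w) = (w - bar w) * a"
    using ab(3) by (simp add: algebra_simps)
  then have "w + bar w = a" using w by auto
  moreover have "w + bar w \<noteq> 0"
    using w two_eq_0[of w] by (metis add_left_cancel)
  ultimately show ?thesis using that ab by blast
qed

text \<open>Otherwise the anisotropic form would vanish at \<open>(u, v, a) = (0, 1, 0)\<close> or
  at \<open>(0, 0, 1)\<close>.\<close>

lemma \<alpha>_nonzero: "\<alpha> \<noteq> 0" and \<beta>_nonzero: "\<beta> \<noteq> 0"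
  using anisotropic[of 0 0 1] anisotropic[of 1 0 0] subfield_K' by (auto simp: is_subfield_def)

lemma square_in_L': "w\<^sup>2 \<in> L'"
  unfolding L'_def by (rule hull_inc) auto

lemma zero_one_in_L': "0 \<in> L'" "1 \<in> L'"
  using square_in_L'[of 0] square_in_L'[of 1] by auto

lemma zero_one_in_V:
  assumes "i > 0"
  shows "0 \<in> V i" "(1, 0, 0) \<in> V i"
  using subfield_K subfield_K' zero_one_in_L' by (auto simp: V_def is_subfield_def zero_prod_def)

text \<open>The parameter must lie in \<open>L'\<close>, which contains all squares; the trace of
  \<open>w\<^sup>2\<close> is the square of the trace of \<open>w\<close>. Membership in
  \<open>V 2\<close> gives access to the injectivity of \<open>e 2\<close>.\<close>

lemma comm13_nonzero:
  obtains s t where "s \<in> V 1" "t \<in> V 3" "comm13 s t \<in> V 2" "comm13 s t \<noteq> 0"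
proof -
  obtain w where w: "w + bar w \<in> K" "w + bar w \<noteq> 0" using nonzero_trace by metis
  have sq: "bar (w\<^sup>2) + w\<^sup>2 = (w + bar w)\<^sup>2"
  proof -
    have "(w + bar w)\<^sup>2 = bar (w\<^sup>2) + w\<^sup>2 + (w * bar w + w * bar w)"
      unfolding power2_eq_square bar_simps(2) by (simp add: algebra_simps)
    then show ?thesis unfolding two_eq_0 by simp
  qed
  have b1: "bar 1 = 1" and b0: "bar 0 = 0" using bar_simps(3) K_simps by auto
  have eq: "comm13 (1, 0, 0) (w\<^sup>2, 0, 0) = (0, 0, \<alpha> * (w + bar w)\<^sup>2)"
    by (simp add: b1 b0 flip: sq)
  have "(w + bar w)\<^sup>2 \<in> K'" using squares_subset w by blast
  then have "\<alpha> * (w + bar w)\<^sup>2 \<in> K'" using subfield_K' \<alpha>_in by (simp add: is_subfield_def)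
  then have "comm13 (1, 0, 0) (w\<^sup>2, 0, 0) \<in> V 2" unfolding eq by (simp add: V_def)
  moreover have "comm13 (1, 0, 0) (w\<^sup>2, 0, 0) \<noteq> 0"
    unfolding eq using \<alpha>_nonzero w by (simp add: zero_prod_def)
  moreover have "(w\<^sup>2, 0, 0) \<in> V 3" using square_in_L' zero_one_in_L' K_simps by (simp add: V_def)
  moreover have "(1, 0, 0) \<in> V 1" by (rule zero_one_in_V) simp
  ultimately show ?thesis using that by blast
qed

text \<open>Here the first coordinates range over the whole field, so \<open>w\<close> itself
  serves.\<close>

lemma comm24_nonzero:
  obtains s t where "s \<in> V 2" "t \<in> V 4" "comm24 s t \<in> V 3" "comm24 s t \<noteq> 0"
proof -
  obtain w where w: "w + bar w \<in> K" "w + bar w \<noteq> 0" using nonzero_trace by metis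
  have b1: "bar 1 = 1" and b0: "bar 0 = 0" using bar_simps(3) K_simps by auto
  have eq: "comm24 (1, 0, 0) (w, 0, 0) = (0, 0, inverse \<beta> * (w + bar w))"
    by (simp add: b1 b0 add.commute)
  have "inverse \<beta> * (w + bar w) \<in> K" using w \<beta>_in by (blast intro: K_simps)
  then have "comm24 (1, 0, 0) (w, 0, 0) \<in> V 3"
    unfolding eq using zero_one_in_L' by (simp add: V_def)
  moreover have "comm24 (1, 0, 0) (w, 0, 0) \<noteq> 0"
    unfolding eq using \<beta>_nonzero w by (simp add: zero_prod_def)
  moreover have "(w, 0, 0) \<in> V 4" using subfield_K' by (simp add: V_def is_subfield_def)
  moreover have "(1, 0, 0) \<in> V 2" by (rule zero_one_in_V) simp
  ultimately show ?thesis using that by blast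
qed

end

lemma commutator_eq_id_iff:
  assumes "bij g" "bij h"
  shows "commutator g h = id \<longleftrightarrow> g \<circ> h = h \<circ> g"
proof -
  have "commutator g h y = y \<longleftrightarrow> g (h y) = h (g y)" for y
    using assms unfolding commutator_def by (metis bij_inv_eq_iff comp_apply)
  then show ?thesis by (simp add: fun_eq_iff)
qed

section \<open>Root groups of the coordinatizing apartment\<close>

context F4_coordinates
begin

lemma root_group_elations:
  "root_group Pt Ln inc x i = elations Pt Ln inc (x (i + 1)) (x (i + 2)) (x (i + 3))"
  by (simp add: root_group_def elations_def)

lemma e_in: "i \<in> {1..4} \<Longrightarrow> s \<in> V i \<Longrightarrow> e i s \<in> root_group Pt Ln inc x i"
  using e_bij by (meson bij_betwE)

lemma e_surj:
  assumes "i \<in> {1..4}" "f \<in> root_group Pt Ln inc x i"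
  obtains s where "s \<in> V i" "f = e i s"
  using assms e_bij[of i] unfolding bij_betw_def by blast

lemma bij_e: "i \<in> {1..4} \<Longrightarrow> s \<in> V i \<Longrightarrow> bij (e i s)"
  using e_in[of i s] by (simp add: root_group_def automorphism_def)

lemma e_eq_id:
  assumes "i \<in> {1..4}" "s \<in> V i" "e i s = id"
  shows "s = 0"
proof -
  have 0: "0 \<in> V i" using assms by (intro zero_one_in_V) simp
  have "e i 0 = e i 0 \<circ> e i 0" using e_hom[OF assms(1) 0 0] by simp
  then have "e i 0 y = y" for y
    using bij_e[OF assms(1) 0] by (metis bij_is_inj comp_apply inj_eq)
  then have "e i 0 = e i s" using assms by auto
  then show ?thesis using e_bij[OF assms(1)] assms(2) 0 by (metis bij_betw_def inj_on_eq_iff)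
qed

lemma root_group_abelian:
  assumes "i \<in> {1..4}" "f \<in> root_group Pt Ln inc x i" "g \<in> root_group Pt Ln inc x i"
  shows "f \<circ> g = g \<circ> f"
  using assms e_hom[OF assms(1)] by (metis add.commute e_surj)

lemma root_groups_adjacent:
  assumes "i \<in> {1..3}" "f \<in> root_group Pt Ln inc x i" "g \<in> root_group Pt Ln inc x (i + 1)"
  shows "f \<circ> g = g \<circ> f"
proof -
  have i: "i \<in> {1..4}" "i + 1 \<in> {1..4}" using assms by auto
  obtain s where s: "s \<in> V i" "f = e i s" using e_surj[OF i(1) assms(2)] by metis
  obtain t where t: "t \<in> V (i + 1)" "g = e (i + 1) t" using e_surj[OF i(2) assms(3)] by metis
  show ?thesis
    using comm_trivial[OF assms(1) s(1) t(1)] bij_e[OF i(1) s(1)] bij_e[OF i(2) t(1)] s t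
    by (simp add: commutator_eq_id_iff)
qed

lemma root_groups_noncommuting:
  assumes "i \<in> {1, 2}"
  shows "\<exists>f\<in>root_group Pt Ln inc x i. \<exists>g\<in>root_group Pt Ln inc x (i + 2). f \<circ> g \<noteq> g \<circ> f"
proof -
  have "\<exists>s\<in>V i. \<exists>t\<in>V (i + 2). commutator (e i s) (e (i + 2) t) \<noteq> id"
  proof (cases "i = 1")
    case True
    obtain s t where "s \<in> V 1" "t \<in> V 3" "comm13 s t \<in> V 2" "comm13 s t \<noteq> 0"
      using comm13_nonzero by metis
    moreover have "e 2 (comm13 s t) \<noteq> id"
      using e_eq_id[of 2 "comm13 s t"] calculation by auto
    ultimately show ?thesis using True comm_1_3 by (intro bexI[of _ s] bexI[of _ t]) (auto simp: numeral_3_eq_3)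
  next
    case False
    then have i: "i = 2" using assms by simp
    obtain s t where "s \<in> V 2" "t \<in> V 4" "comm24 s t \<in> V 3" "comm24 s t \<noteq> 0"
      using comm24_nonzero by metis
    moreover have "e 3 (comm24 s t) \<noteq> id"
      using e_eq_id[of 3 "comm24 s t"] calculation by auto
    ultimately show ?thesis unfolding i using comm_2_4 by (intro bexI[of _ s] bexI[of _ t]) auto
  qed
  then obtain s t where st: "s \<in> V i" "t \<in> V (i + 2)" "commutator (e i s) (e (i + 2) t) \<noteq> id"
    by blast
  have i: "i \<in> {1..4}" "i + 2 \<in> {1..4}" using assms by auto
  have "e i s \<circ> e (i + 2) t \<noteq> e (i + 2) t \<circ> e i s"
    using st bij_e[OF i(1) st(1)] bij_e[OF i(2) st(2)] by (simp add: commutator_eq_id_iff)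
  then show ?thesis using e_in i st by blast
qed

lemma noncommuting_elations_apartment:
  assumes "i \<in> {1, 2}"
  shows "noncommuting_elations Pt Ln inc (x (i + 1)) (x (i + 2)) (x (i + 3)) (x (i + 4)) (x (i + 5))"
proof -
  \<comment> \<open>The inner vertices of the root starting at \<open>x i\<close> begin with
    \<open>x (i + 1)\<close>, hence the shift.\<close>
  have U: "elations Pt Ln inc (x (i + 1)) (x (i + 2)) (x (i + 3)) = root_group Pt Ln inc x i"
    "elations Pt Ln inc (x (i + 2)) (x (i + 3)) (x (i + 4)) = root_group Pt Ln inc x (i + 1)"
    "elations Pt Ln inc (x (i + 3)) (x (i + 4)) (x (i + 5)) = root_group Pt Ln inc x (i + 2)"
    by (simp_all add: root_group_elations eval_nat_numeral)
  have i: "i \<in> {1..3}" "i + 1 \<in> {1..3}" "i + 1 \<in> {1..4}" "i + 1 + 1 = i + 2" using assms by auto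
  show ?thesis
    unfolding noncommuting_elations_def U
    using root_groups_adjacent[OF i(1)] root_groups_adjacent[OF i(2)] root_group_abelian[OF i(3)]
      root_groups_noncommuting[OF assms] unfolding i(4) by blast
qed

text \<open>The bound keeps all indices below 8, where the labelling is injective.\<close>

lemma path5_apartment:
  assumes "i \<le> 3"
  shows "path5 inc (x i) (x (i + 1)) (x (i + 2)) (x (i + 3)) (x (i + 4))"
proof -
  have "inj_on x {..<8}" "inc (x j) (x (Suc j))" for j using apartment by (simp_all add: apartment_def)
  then show ?thesis using assms by (simp add: path5_def inj_on_eq_iff eval_nat_numeral)
qed

text \<open>Exactly one of \<open>x 2\<close> and \<open>x 3\<close> is a point, so one of the two cases
  \<open>[U\<^sub>1, U\<^sub>3] \<noteq> 1\<close>, \<open>[U\<^sub>2, U\<^sub>4] \<noteq> 1\<close> applies to paths starting at a point.\<close>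

lemma noncommuting_elations_path5:
  assumes path: "path5 inc a b c d f" and a: "a \<in> Pt"
  shows "noncommuting_elations Pt Ln inc a b c d f"
proof -
  have "inc (x 2) (x (2 + 1))" using apartment unfolding apartment_def by blast
  then have "x 2 \<in> Pt \<longleftrightarrow> x 3 \<notin> Pt" using inc_type_neq by simp
  then obtain i :: nat where i: "i \<in> {1, 2}" "x (i + 1) \<in> Pt"
    by (cases "x 2 \<in> Pt") (force simp: numeral_3_eq_3 numeral_2_eq_2)+
  have "path5 inc (x (i + 1)) (x (i + 2)) (x (i + 3)) (x (i + 4)) (x (i + 5))"
    using path5_apartment[of "i + 1"] i(1) by (auto simp: eval_nat_numeral)
  then obtain g where g: "automorphism Pt Ln inc g" "g (x (i + 1)) = a" "g (x (i + 2)) = b"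
    "g (x (i + 3)) = c" "g (x (i + 4)) = d" "g (x (i + 5)) = f"
    using path5_transitive[OF _ path] i a by metis
  show ?thesis
    using noncommuting_elations_automorphism[OF g(1) noncommuting_elations_apartment[OF i(1)]] g
    by simp
qed

end

section \<open>Stabilizers of the set of absolute points\<close>

lemma (in generalized_quadrangle) polarity_conjugate:
  assumes r: "polarity Pt Ln inc \<rho>" and a: "automorphism Pt Ln inc \<phi>"
  shows "polarity Pt Ln inc (\<phi> \<circ> \<rho> \<circ> inv \<phi>)"
    and "absolute_points Pt inc (\<phi> \<circ> \<rho> \<circ> inv \<phi>) = \<phi> ` absolute_points Pt inc \<rho>"
proof -
  have b: "bij \<phi>" using a by (simp add: automorphism_def)
  have inv1: "inv \<phi> (\<phi> y) = y" and inv2: "\<phi> (inv \<phi> y) = y" for y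
    using b by (simp_all add: bij_is_inj bij_is_surj surj_f_inv_f)
  note ai = automorphism_inv[OF a]
  have im: "\<phi> ` Pt = Pt" "\<phi> ` Ln = Ln" "inv \<phi> ` Pt = Pt" "inv \<phi> ` Ln = Ln"
    using a ai by (simp_all add: automorphism_def)
  show "polarity Pt Ln inc (\<phi> \<circ> \<rho> \<circ> inv \<phi>)"
    unfolding polarity_def
  proof (intro conjI allI impI)
    show "(\<phi> \<circ> \<rho> \<circ> inv \<phi>) \<circ> (\<phi> \<circ> \<rho> \<circ> inv \<phi>) = id"
      by (simp add: fun_eq_iff inv1 inv2 polarity_simps[OF r])
    show "(\<phi> \<circ> \<rho> \<circ> inv \<phi>) ` Pt = Ln" "(\<phi> \<circ> \<rho> \<circ> inv \<phi>) ` Ln = Pt"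
      using r im unfolding image_comp[symmetric] by (simp_all add: polarity_def)
    show "inc ((\<phi> \<circ> \<rho> \<circ> inv \<phi>) y) ((\<phi> \<circ> \<rho> \<circ> inv \<phi>) z)" if "inc y z" for y z
      using that by (simp add: automorphism_inc[OF a] automorphism_inc[OF ai] polarity_simps[OF r])
  qed
  have iff: "y \<in> absolute_points Pt inc (\<phi> \<circ> \<rho> \<circ> inv \<phi>) \<longleftrightarrow> inv \<phi> y \<in> absolute_points Pt inc \<rho>" for y
    using automorphism_inc[OF a, of "inv \<phi> y"] automorphism_Pt[OF ai]
    by (simp add: absolute_points_def inv2)
  show "absolute_points Pt inc (\<phi> \<circ> \<rho> \<circ> inv \<phi>) = \<phi> ` absolute_points Pt inc \<rho>"
  proof (intro set_eqI iffI)
    fix y assume "y \<in> absolute_points Pt inc (\<phi> \<circ> \<rho> \<circ> inv \<phi>)"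
    then show "y \<in> \<phi> ` absolute_points Pt inc \<rho>" using iff inv2 by (metis imageI)
  next
    fix y assume "y \<in> \<phi> ` absolute_points Pt inc \<rho>"
    then show "y \<in> absolute_points Pt inc (\<phi> \<circ> \<rho> \<circ> inv \<phi>)" using iff inv1 by auto
  qed
qed

text \<open>This reduces the claim about absolute lines to commuting with
  \<open>\<rho>\<close>.\<close>

lemma (in generalized_quadrangle) absolute_lines_eq:
  assumes "polarity Pt Ln inc \<rho>"
  shows "absolute_lines Ln inc \<rho> = \<rho> ` absolute_points Pt inc \<rho>"
proof (intro set_eqI iffI)
  have Ln: "y \<in> Ln \<longleftrightarrow> y \<notin> Pt" for y using Pt_Ln by blast
  fix y
  show "y \<in> \<rho> ` absolute_points Pt inc \<rho>" if "y \<in> absolute_lines Ln inc \<rho>"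
  proof
    show "y = \<rho> (\<rho> y)" by (simp add: polarity_simps[OF assms])
    show "\<rho> y \<in> absolute_points Pt inc \<rho>"
      using that inc_sym by (simp add: absolute_lines_def absolute_points_def Ln polarity_simps[OF assms])
  qed
  show "y \<in> absolute_lines Ln inc \<rho>" if "y \<in> \<rho> ` absolute_points Pt inc \<rho>"
    using that inc_sym by (auto simp: absolute_lines_def absolute_points_def Ln polarity_simps[OF assms])
qed

theorem corollary3p3:
  fixes K K' :: "'f::field set" and bar :: "'f \<Rightarrow> 'f" and \<alpha> \<beta> :: 'f
    and Pt Ln :: "'v set" and inc :: "'v \<Rightarrow> 'v \<Rightarrow> bool" and \<rho> :: "'v \<Rightarrow> 'v"
  assumes "exceptional_F4_quadrangle K K' bar \<alpha> \<beta> Pt Ln inc"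
    and "polarity Pt Ln inc \<rho>"
  shows "\<forall>\<phi>. automorphism Pt Ln inc \<phi>
      \<and> \<phi> ` absolute_points Pt inc \<rho> = absolute_points Pt inc \<rho>
    \<longrightarrow> \<phi> ` absolute_lines Ln inc \<rho> = absolute_lines Ln inc \<rho> \<and> \<phi> \<circ> \<rho> = \<rho> \<circ> \<phi>"
proof (intro allI impI, elim conjE)
  fix \<phi>
  assume a: "automorphism Pt Ln inc \<phi>"
    and stab: "\<phi> ` absolute_points Pt inc \<rho> = absolute_points Pt inc \<rho>"
  obtain x e where "F4_coordinates K K' bar \<alpha> \<beta> Pt Ln inc x e"
    using assms(1) by (auto simp: exceptional_F4_quadrangle_def)
  then interpret F4_coordinates K K' bar \<alpha> \<beta> Pt Ln inc x e .
  note conj = polarity_conjugate[OF assms(2) a]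
  have eq: "absolute_points Pt inc (\<phi> \<circ> \<rho> \<circ> inv \<phi>) = absolute_points Pt inc \<rho>"
    using conj(2) stab by simp
  have "\<phi> \<circ> \<rho> \<circ> inv \<phi> = \<rho>"
    using polarities_agree_on_absolute_points[OF assms(2) conj(1) eq noncommuting_elations_path5]
    by (intro polarity_eqI[OF assms(2) conj(1) eq]) blast
  then have comm: "\<phi> \<circ> \<rho> = \<rho> \<circ> \<phi>"
    using a by (metis automorphism_def bij_is_inj comp_assoc comp_id inv_o_cancel)
  have "\<phi> ` absolute_lines Ln inc \<rho> = \<rho> ` \<phi> ` absolute_points Pt inc \<rho>"
    unfolding absolute_lines_eq[OF assms(2)] image_comp comm ..
  then show "\<phi> ` absolute_lines Ln inc \<rho> = absolute_lines Ln inc \<rho> \<and> \<phi> \<circ> \<rho> = \<rho> \<circ> \<phi>"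
    using comm stab absolute_lines_eq[OF assms(2)] by simp
qed

end
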